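(* Let $\tau\in\mathbb{C}$ with $\mathrm{Im}(\tau)>0$, $q=e^{2\pi i\tau}$, let $k$ be an integer and $u,v,z\in\mathbb{C}$ with $u,v,u+z,v+z\notin\mathbb{Z}+\mathbb{Z}\tau$ (the conditions on $z$ being needed only in (iv)). Then: (i) $\mu(u+1,v;k)=\mu(u,v+1;k)=(-1)^k\mu(u,v;k)$. (ii) $\mu(u+\tau,v;k)=-e^{2\pi i(u-v)}q^{\frac k2}\mu(u,v;k)+e^{\pi i(u-v)}q^{\frac k2}\mu(u,v;k-1)$. (iii) $\mu(u-\tau,v;k)=q^{\frac k2}\mu(u,v;k)-2i\,e^{-\pi i(u-v)}\sin(\pi k\tau)\,\mu(u,v;k+1)$. (iv) $$\mu(u+z,v+z;k+1)=\mu(u,v;k+1)+\frac{i\,q^{\frac18}(q)_\infty^3\vartheta_{11}(z)\vartheta_{11}(u+v+z)}{\vartheta_{11}(u)\vartheta_{11}(v)\vartheta_{11}(u+z)\vartheta_{11}(v+z)}\cdot\frac{e^{-\pi ik(u-v)}}{(q^{-k})_k}\;{}_1\phi_1\left(\begin{matrix}q^{-k}\\0\end{matrix};q,e^{2\pi i(u-v)}q\right).$$ (v) $\mu(u,v;k)=\mu(u+\tau,v+\tau;k)=\mu(v,u;k)=\mu(-u,-v;k)$. (vi) $2\cos(\pi(u-v))\,\mu(u,v;k)=(1-q^{-k})\mu(u,v;k+1)+\mu(u,v;k-1)$. (vii) If moreover $k$ is a positive integer, then $$\mu(u,v;k)=\frac{e^{\pi ik(u-v)}}{\vartheta_{11}(v)}\sum_{n\in\mathbb{Z}}(-1)^ne^{2\pi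 i(n+\frac12)v}q^{\frac{n(n+1)}{2}}\prod_{l=0}^{k-1}\frac{1}{1-e^{2\pi iu}q^{n-l}}$$ $$=e^{\pi i(k-1)(u-v+\tau)}\sum_{j=0}^{k-1}\frac{(-1)^{k-1-j}}{(q)_j(q)_{k-1-j}}\,q^{\frac{(k-1-j)^2}{2}}\,\mu(u-j\tau,v).$$
   Context: Powers: $q^s:=e^{2\pi is\tau}$. $(x)_\infty=(x;q)_\infty=\prod_{j\ge0}(1-xq^j)$, $(x)_n=(x)_\infty/(q^nx)_\infty$ for $n\in\mathbb{Z}$; in particular $(q^{-k})_k=\prod_{j=0}^{k-1}(1-q^{-k+j})$ for $k\ge0$, and for $k<0$ the factor $1/(q^{-k})_k$ is $(1)_\infty/(q^{-k})_\infty=0$. $\vartheta_{11}(u)=\sum_{n\in\mathbb{Z}}e^{2\pi i(n+\frac12)(u+\frac12)+\pi i(n+\frac12)^2\tau}$. ${}_1\phi_1\left(\begin{matrix}A\\0\end{matrix};q,x\right)=\sum_{n\ge0}\frac{(A)_n}{(q)_n}(-1)^nq^{n(n-1)/2}x^n$. Generalized $\mu$-function: for $\alpha,u,v\in\mathbb{C}$ with $u-\alpha\tau,v\notin\mathbb{Z}+\mathbb{Z}\tau$, $$\mu(u,v;\alpha)=\frac{e^{\pi i\alpha(u-v)}}{\vartheta_{11}(v)}\sum_{n\in\mathbb{Z}}(-1)^ne^{2\pi i(n+\frac12)v}q^{\frac{n(n+1)}2}\frac{(e^{2\pi iu}q^{n+1})_\infty}{(e^{2\pi iu}q^{n-\alpha+1})_\infty}.$$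 Zwegers' $\mu$-function is $\mu(u,v)=\mu(u,v;1)=\frac{e^{\pi iu}}{\vartheta_{11}(v)}\sum_{n\in\mathbb{Z}}\frac{(-1)^ne^{2\pi inv}q^{n(n+1)/2}}{1-e^{2\pi iu}q^n}$. *)

theory Defs
  imports "HOL-Analysis.Analysis"
begin

definition period_lattice :: "complex \<Rightarrow> complex set" where
  "period_lattice \<tau> = {of_int m + of_int n * \<tau> | m n. True}"

(* Powers of q are q^s = exp (2 pi i s tau) with tau, not q, as the given datum, so that no
   branch of the logarithm is involved for non-integral s. *)
definition q_pow :: "complex \<Rightarrow> complex \<Rightarrow> complex" where
  "q_pow \<tau> s = exp (2 * of_real pi * \<i> * s * \<tau>)"

definition q_poch_inf :: "complex \<Rightarrow> complex \<Rightarrow> complex" where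
  "q_poch_inf q x = (\<Prod>j. 1 - x * q ^ j)"

(* For n >= 0 the quotient (x)_inf / (q^n x)_inf is read as the finite product to which it
   reduces; this reading is needed for x = q^(-m), where the quotient may be 0 / 0. *)
definition q_poch :: "complex \<Rightarrow> complex \<Rightarrow> int \<Rightarrow> complex" where
  "q_poch q x n =
     (if 0 \<le> n then (\<Prod>j<nat n. 1 - x * q ^ j)
      else q_poch_inf q x / q_poch_inf q (q powi n * x))"

(* The factor 1 / (x)_n. For n < 0 it is (q^n x)_inf / (x)_inf, which makes sense (and is 0)
   also where (x)_n has a pole, as for x = q^(-n). *)
definition q_poch_recip :: "complex \<Rightarrow> complex \<Rightarrow> int \<Rightarrow> complex" where
  "q_poch_recip q x n =
     (if 0 \<le> n then 1 / q_poch q x n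
      else q_poch_inf q (q powi n * x) / q_poch_inf q x)"

definition theta11 :: "complex \<Rightarrow> complex \<Rightarrow> complex" where
  "theta11 \<tau> u =
     (\<Sum>\<^sub>\<infinity>n\<in>(UNIV :: int set).
        exp (2 * of_real pi * \<i> * (of_int n + 1/2) * (u + 1/2)
             + of_real pi * \<i> * (of_int n + 1/2)\<^sup>2 * \<tau>))"

(* The basic hypergeometric series 1phi1 with upper parameter A and lower parameter 0. *)
definition phi11_0 :: "complex \<Rightarrow> complex \<Rightarrow> complex \<Rightarrow> complex" where
  "phi11_0 q A x =
     (\<Sum>n. q_poch q A (int n) / q_poch q q (int n)
            * (-1) ^ n * q ^ (n * (n - 1) div 2) * x ^ n)"

(* The generalized mu-function mu(u, v; alpha), for v and u - alpha tau outside the lattice. *)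
definition gen_mu :: "complex \<Rightarrow> complex \<Rightarrow> complex \<Rightarrow> complex \<Rightarrow> complex" where
  "gen_mu \<tau> u v \<alpha> =
     exp (of_real pi * \<i> * \<alpha> * (u - v)) / theta11 \<tau> v *
     (\<Sum>\<^sub>\<infinity>n\<in>(UNIV :: int set).
        (-1) powi n * exp (2 * of_real pi * \<i> * (of_int n + 1/2) * v)
        * q_pow \<tau> (of_int n * (of_int n + 1) / 2)
        * (q_poch_inf (q_pow \<tau> 1) (exp (2 * of_real pi * \<i> * u) * q_pow \<tau> (of_int n + 1))
           / q_poch_inf (q_pow \<tau> 1) (exp (2 * of_real pi * \<i> * u) * q_pow \<tau> (of_int n - \<alpha> + 1))))"

(* Zwegers' mu-function, by its Appell-Lerch series; it agrees with mu(u, v; 1). *)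
definition zwegers_mu :: "complex \<Rightarrow> complex \<Rightarrow> complex \<Rightarrow> complex" where
  "zwegers_mu \<tau> u v =
     exp (of_real pi * \<i> * u) / theta11 \<tau> v *
     (\<Sum>\<^sub>\<infinity>n\<in>(UNIV :: int set).
        (-1) powi n * exp (2 * of_real pi * \<i> * of_int n * v)
        * q_pow \<tau> (of_int n * (of_int n + 1) / 2)
        / (1 - exp (2 * of_real pi * \<i> * u) * q_pow \<tau> (of_int n)))"

end

theory Submission
  imports Defs
begin

text \<open>
  In the multiplicative variables \<open>x = exp (2 \<pi> \<i> u)\<close>, \<open>y = exp (2 \<pi> \<i> v)\<close>, and with
  \<open>w = exp (\<pi> \<i> (u - v))\<close>, so that \<open>w\<^sup>2 = x / y\<close>, the function \<open>\<mu>(u, v; k)\<close> is, up to a constant,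
  \<open>w\<^sup>k S\<^sub>k(x, y) / \<Theta>(y)\<close>, where \<open>\<Theta>(y) = \<Sum>\<^sub>n t\<^sub>n y\<^sup>n\<close> with \<open>t\<^sub>n = (-1)\<^sup>n q\<^bsup>n(n+1)/2\<^esup>\<close> and
  \<open>S\<^sub>k(x, y) = \<Sum>\<^sub>n t\<^sub>n y\<^sup>n F\<^sub>k(x q\<^sup>n)\<close>. For an integer \<open>k\<close> the factor \<open>F\<^sub>k\<close> is rational; it is the product of
  the \<open>1 / (1 - X q\<^bsup>-l\<^esup>)\<close> over \<open>0 \<le> l < k\<close> if \<open>k\<close> is positive, a polynomial if \<open>k\<close> is negative. Parts (i), (ii)
  and (iii) reflect how \<open>w\<close>, \<open>\<Theta>\<close> and \<open>F\<^sub>k\<close> change under the shifts: \<open>F\<^sub>k\<close>, \<open>F\<^sub>k(X / q)\<close> and \<open>F\<^sub>k\<^sub>+\<^sub>1\<close> differ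
  by linear factors, and \<open>t\<^sub>n\<^sub>+\<^sub>1 = - q\<^bsup>n+1\<^esup> t\<^sub>n\<close> absorbs the powers of \<open>q\<^sup>n\<close> that remain. Eliminating the
  shifted variable between (ii) and (iii) yields the three-term recurrence (vi). The two
  formulas of (vii) express the product form of \<open>F\<^sub>k\<close> and its partial fraction expansion.

  The recurrence (vi) reduces (iv) and (v) to the indices \<open>0\<close> and \<open>1\<close> of \<open>\<mu>\<close>
  (\<open>three_term_recurrence_unique\<close>): its coefficients depend on \<open>u\<close> and \<open>v\<close> only through
  \<open>cos (\<pi> (u - v))\<close>, and \<open>\<mu>(u, v; 0)\<close> is a constant. For (iv) one also needs that the
  \<open>\<^sub>1\<phi>\<^sub>1\<close> factor, which is up to normalization a Rogers-Szego polynomial in base \<open>1 / q\<close>, obeys the same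
  recurrence.

  At index \<open>1\<close>, the formula (iv) is Zwegers' translation formula. Here the combination
  \<open>\<Theta>(y) S\<^sub>1(x z, y z) - \<Theta>(y z) S\<^sub>1(x, y)\<close> is a Laurent series in \<open>y\<close> whose coefficients, computed as
  convolutions, satisfy the first-order recurrence of the coefficients of \<open>\<Theta>(x y z)\<close>. So it is a multiple
  of \<open>\<Theta>(x y z)\<close> (\<open>appell_lerch_translation\<close>). The factor is found at \<open>y = 1\<close>, where \<open>\<Theta>\<close> vanishes and \<open>S\<^sub>1(x, 1)\<close> is
  the classical expansion \<open>- (q)\<^sub>\<infinity>\<^sup>3 / (x \<Theta>(x))\<close>. That expansion and the Jacobi triple product, which
  also gives the zeros of \<open>\<Theta>\<close>, are both limits of finite identities with the weights
  \<open>1 / ((q)\<^bsub>N-n\<^esub> (q)\<^bsub>N+n\<^esub>)\<close> (\<open>finite_jacobi_triple_product\<close>, \<open>finite_lerch_product\<close>).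
  Part (v) at index \<open>1\<close> follows: \<open>z = \<tau>\<close> gives the shift by \<open>\<tau>\<close>, and \<open>z = - u - v\<close> together with the
  reflection \<open>n \<mapsto> - n\<close> gives the symmetry in \<open>u\<close> and \<open>v\<close>.
\<close>

section \<open>Sums over the integers\<close>

text \<open>This growth class contains the powers \<open>y\<^sup>n\<close> and the factors \<open>1 / (1 - x q\<^sup>n)\<close>, is closed under
  products and translations, and is still dominated by the decay of \<open>q\<^bsup>n(n+1)/2\<^esup>\<close>. Absolute convergence of
  the bilateral series below can therefore be read off from the shape of their summands.\<close>

definition exp_bounded :: "(int \<Rightarrow> complex) \<Rightarrow> bool" where
  "exp_bounded F \<longleftrightarrow> (\<exists>C R. 0 \<le> C \<and> 1 \<le> R \<and> (\<forall>n. norm (F n) \<le> C * R ^ nat \<bar>n\<bar>))"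

lemma exp_boundedI:
  assumes "\<And>n. norm (F n) \<le> C * R ^ nat \<bar>n\<bar>" and "1 \<le> R"
  shows "exp_bounded F"
proof -
  have "0 \<le> C" using assms(1)[of 0] norm_ge_zero[of "F 0"] by (simp del: norm_ge_zero)
  then show ?thesis using assms unfolding exp_bounded_def by blast
qed

lemma exp_bounded_of_bounded:
  assumes "\<And>n. norm (F n) \<le> C"
  shows "exp_bounded F"
  using assms by (intro exp_boundedI[of F C 1]) auto

lemma exp_bounded_const: "exp_bounded (\<lambda>n. c)"
  by (rule exp_bounded_of_bounded[of _ "norm c"]) simp

lemma exp_bounded_mult:
  assumes "exp_bounded F" "exp_bounded G"
  shows "exp_bounded (\<lambda>n. F n * G n)"
proof -
  from assms obtain C R D S where
    F: "0 \<le> C" "1 \<le> R" "\<And>n. norm (F n) \<le> C * R ^ nat \<bar>n\<bar>" and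
    G: "0 \<le> D" "1 \<le> S" "\<And>n. norm (G n) \<le> D * S ^ nat \<bar>n\<bar>"
    unfolding exp_bounded_def by blast
  show ?thesis
  proof (rule exp_boundedI)
    fix n
    have "norm (F n * G n) \<le> (C * R ^ nat \<bar>n\<bar>) * (D * S ^ nat \<bar>n\<bar>)"
      unfolding norm_mult using F G by (intro mult_mono) auto
    then show "norm (F n * G n) \<le> (C * D) * (R * S) ^ nat \<bar>n\<bar>"
      by (simp add: power_mult_distrib algebra_simps)
    show "1 \<le> R * S" using mult_mono[of 1 R 1 S] F G by simp
  qed
qed

lemma exp_bounded_add:
  assumes "exp_bounded F" "exp_bounded G"
  shows "exp_bounded (\<lambda>n. F n + G n)"
proof -
  from assms obtain C R D S where
    F: "0 \<le> C" "1 \<le> R" "\<And>n. norm (F n) \<le> C * R ^ nat \<bar>n\<bar>" and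
    G: "0 \<le> D" "1 \<le> S" "\<And>n. norm (G n) \<le> D * S ^ nat \<bar>n\<bar>"
    unfolding exp_bounded_def by blast
  show ?thesis
  proof (rule exp_boundedI)
    fix n
    have "norm (F n) \<le> C * (R + S) ^ nat \<bar>n\<bar>"
      using F G by (intro order_trans[OF F(3)] mult_left_mono power_mono) auto
    moreover have "norm (G n) \<le> D * (R + S) ^ nat \<bar>n\<bar>"
      using F G by (intro order_trans[OF G(3)] mult_left_mono power_mono) auto
    ultimately show "norm (F n + G n) \<le> (C + D) * (R + S) ^ nat \<bar>n\<bar>"
      by (intro norm_triangle_le) (simp add: algebra_simps)
  qed (use F G in auto)
qed

lemma exp_bounded_powi: "exp_bounded (\<lambda>n. y powi n)"
proof (rule exp_boundedI[of _ 1 "1 + norm y + norm (inverse y)"])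
  fix n :: int
  have "norm y ^ nat n \<le> (1 + norm y + norm (inverse y)) ^ nat n"
    by (intro power_mono) auto
  moreover have "norm (inverse y) ^ nat (- n) \<le> (1 + norm y + norm (inverse y)) ^ nat (- n)"
    by (intro power_mono) auto
  ultimately show "norm (y powi n) \<le> 1 * (1 + norm y + norm (inverse y)) ^ nat \<bar>n\<bar>"
    by (cases "0 \<le> n") (auto simp: power_int_def norm_power)
qed auto

lemma exp_bounded_affine:
  assumes "exp_bounded F" and "\<bar>e\<bar> = 1"
  shows "exp_bounded (\<lambda>n. F (k + e * n))"
proof -
  from assms obtain C R where
    F: "0 \<le> C" "1 \<le> R" "\<And>n. norm (F n) \<le> C * R ^ nat \<bar>n\<bar>"
    unfolding exp_bounded_def by blast
  show ?thesis
  proof (rule exp_boundedI)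
    fix n
    have "\<bar>k + e * n\<bar> \<le> \<bar>k\<bar> + \<bar>n\<bar>"
      using assms(2) abs_triangle_ineq[of k "e * n"] by (simp add: abs_mult)
    then have "nat \<bar>k + e * n\<bar> \<le> nat \<bar>k\<bar> + nat \<bar>n\<bar>" by linarith
    then have "R ^ nat \<bar>k + e * n\<bar> \<le> R ^ nat \<bar>k\<bar> * R ^ nat \<bar>n\<bar>"
      using F(2) by (simp flip: power_add add: power_increasing)
    with F(1) have "C * R ^ nat \<bar>k + e * n\<bar> \<le> C * (R ^ nat \<bar>k\<bar> * R ^ nat \<bar>n\<bar>)"
      by (rule mult_left_mono[rotated])
    with F(3)[of "k + e * n"] show "norm (F (k + e * n)) \<le> (C * R ^ nat \<bar>k\<bar>) * R ^ nat \<bar>n\<bar>"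
      by (simp add: algebra_simps)
  qed (use F in auto)
qed

lemma exp_bounded_shift: "exp_bounded F \<Longrightarrow> exp_bounded (\<lambda>n. F (n + k))"
  using exp_bounded_affine[of F 1 k] by (simp add: add.commute)

lemma exp_bounded_reflect: "exp_bounded F \<Longrightarrow> exp_bounded (\<lambda>n. F (k - n))"
  using exp_bounded_affine[of F "-1" k] by simp

lemma exp_bounded_cong:
  "exp_bounded F \<Longrightarrow> (\<And>n. G n = F n) \<Longrightarrow> exp_bounded G"
  by (simp add: exp_bounded_def)

lemma infsum_int_shift: "(\<Sum>\<^sub>\<infinity>n. f (n + k :: int)) = (\<Sum>\<^sub>\<infinity>n. f n)"
  by (rule infsum_reindex_bij_witness[where j = "\<lambda>n. n + k" and i = "\<lambda>n. n - k"]) auto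

lemma infsum_int_reflect: "(\<Sum>\<^sub>\<infinity>n. f (- n :: int)) = (\<Sum>\<^sub>\<infinity>n. f n)"
  by (rule infsum_reindex_bij_witness[where j = uminus and i = uminus]) auto

lemma infsum_finite_sum:
  fixes f :: "'i \<Rightarrow> 'a \<Rightarrow> complex"
  assumes "finite I" "\<And>i. i \<in> I \<Longrightarrow> f i summable_on A"
  shows "(\<Sum>\<^sub>\<infinity>x\<in>A. \<Sum>i\<in>I. f i x) = (\<Sum>i\<in>I. \<Sum>\<^sub>\<infinity>x\<in>A. f i x)"
proof -
  have "((\<lambda>x. \<Sum>i\<in>I. f i x) has_sum (\<Sum>i\<in>I. \<Sum>\<^sub>\<infinity>x\<in>A. f i x)) A"
    using assms by (induction I rule: finite_induct) (auto intro!: has_sum_add)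
  then show ?thesis by (rule infsumI)
qed

lemma summable_on_geometric_int:
  fixes c :: real
  assumes "0 \<le> c" "c < 1"
  shows "(\<lambda>n::int. c ^ nat \<bar>n\<bar>) summable_on UNIV"
proof -
  have *: "(\<lambda>n::nat. c ^ n) summable_on UNIV"
    using assms by (intro summable_nonneg_imp_summable_on summable_geometric) auto
  have "(\<lambda>n. c ^ nat \<bar>n\<bar>) summable_on range int"
    by (subst summable_on_reindex) (use * in \<open>auto simp: o_def inj_on_def\<close>)
  moreover have "(\<lambda>n. c ^ nat \<bar>n\<bar>) summable_on range (\<lambda>n. - int n)"
    by (subst summable_on_reindex) (use * in \<open>auto simp: o_def inj_on_def\<close>)
  moreover have "(UNIV :: int set) = range int \<union> range (\<lambda>n. - int n)"
    by (auto simp: image_iff) (metis int_cases2)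
  ultimately show ?thesis by (metis summable_on_union)
qed

text \<open>Tannery's theorem, carried over from series to sums over the integers by an enumeration of the
  integers.\<close>

lemma infsum_int_dominated_convergence:
  fixes f :: "nat \<Rightarrow> int \<Rightarrow> complex"
  assumes "\<And>j. (\<lambda>N. f N j) \<longlonglongrightarrow> g j"
    and "\<And>N j. norm (f N j) \<le> B j"
    and "B summable_on UNIV"
  shows "(\<lambda>N. \<Sum>\<^sub>\<infinity>j. f N j) \<longlonglongrightarrow> (\<Sum>\<^sub>\<infinity>j. g j)"
proof -
  have bij: "bij_betw int_decode UNIV UNIV" by (rule bij_int_decode)
  have g: "norm (g j) \<le> B j" for j
    by (rule LIMSEQ_le_const2[OF tendsto_norm[OF assms(1)]]) (use assms(2) in auto)
  have as_series: "(\<Sum>\<^sub>\<infinity>j. h j) = (\<Sum>i. h (int_decode i))"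
    if "\<And>j. norm (h j) \<le> B j" for h :: "int \<Rightarrow> complex"
  proof -
    have "h summable_on UNIV"
      by (rule Infinite_Sum.abs_summable_summable) (rule Infinite_Sum.abs_summable_on_comparison_test'[OF assms(3)], rule that)
    then have "(\<lambda>i. h (int_decode i)) summable_on UNIV"
      by (subst summable_on_reindex_bij_betw[OF bij])
    then have "(\<lambda>i. h (int_decode i)) sums (\<Sum>\<^sub>\<infinity>i. h (int_decode i))"
      by (intro has_sum_imp_sums has_sum_infsum)
    then show ?thesis
      by (simp add: sums_iff infsum_reindex_bij_betw[OF bij])
  qed
  have "summable (\<lambda>i. B (int_decode i))"
    using assms(3) by (intro summable_on_imp_summable) (subst summable_on_reindex_bij_betw[OF bij])
  then have "(\<lambda>N. \<Sum>i. f N (int_decode i)) \<longlonglongrightarrow> (\<Sum>i. g (int_decode i))"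
    using tannerys_theorem[of "\<lambda>i N. f N (int_decode i)" "\<lambda>i. g (int_decode i)" sequentially
        "\<lambda>i. B (int_decode i)"] assms(1,2)
    by (auto intro!: always_eventually)
  then show ?thesis by (simp add: as_series assms(2) g)
qed

text \<open>The Cauchy product of two Laurent series: \<open>(N, n) \<mapsto> (N - n, n)\<close> permutes the pairs of integers, so an
  absolutely convergent double sum may be collected along its antidiagonals.\<close>

lemma infsum_product_diagonal:
  fixes A B :: "int \<Rightarrow> complex"
  assumes "(\<lambda>m. norm (A m)) summable_on UNIV" "(\<lambda>n. norm (B n)) summable_on UNIV"
  shows "(\<Sum>\<^sub>\<infinity>m. A m) * (\<Sum>\<^sub>\<infinity>n. B n) = (\<Sum>\<^sub>\<infinity>N. \<Sum>\<^sub>\<infinity>n. A (N - n) * B n)"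
    and "(\<lambda>N. \<Sum>\<^sub>\<infinity>n. A (N - n) * B n) summable_on UNIV"
    and "(\<lambda>n. A (N - n) * B n) summable_on UNIV"
proof -
  let ?F = "\<lambda>(m, n). A m * B n" and ?G = "\<lambda>(N, n). A (N - n) * B n"
  have bij: "bij_betw (\<lambda>(N, n). (N - n, n)) (UNIV \<times> UNIV) (UNIV \<times> (UNIV :: int set))"
    by (rule bij_betw_byWitness[where f' = "\<lambda>(m, n). (m + n, n)"]) auto
  have F: "(\<lambda>p. norm (?F p)) summable_on UNIV \<times> UNIV"
    unfolding Infinite_Sum.abs_summable_on_Sigma_iff
    using assms by (auto simp: norm_mult infsum_cmult_right' abs_mult intro!: summable_on_cmult_left summable_on_cmult_right)
  then have F': "?F summable_on UNIV \<times> UNIV" by (rule Infinite_Sum.abs_summable_summable)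
  have G: "?G summable_on UNIV \<times> UNIV"
    using F' summable_on_reindex_bij_betw[OF bij, of ?F] by (simp add: case_prod_unfold)
  have "(\<Sum>\<^sub>\<infinity>m. A m) * (\<Sum>\<^sub>\<infinity>n. B n) = (\<Sum>\<^sub>\<infinity>m. \<Sum>\<^sub>\<infinity>n. A m * B n)"
    by (simp add: infsum_cmult_right' infsum_cmult_left')
  also have "\<dots> = infsum ?F (UNIV \<times> UNIV)"
    using infsum_Sigma_banach[OF F'] by simp
  also have "\<dots> = infsum ?G (UNIV \<times> UNIV)"
    using infsum_reindex_bij_betw[OF bij, of ?F] by (simp add: case_prod_unfold)
  also have "\<dots> = (\<Sum>\<^sub>\<infinity>N. \<Sum>\<^sub>\<infinity>n. A (N - n) * B n)"
    using infsum_Sigma_banach[OF G] by simp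
  finally show "(\<Sum>\<^sub>\<infinity>m. A m) * (\<Sum>\<^sub>\<infinity>n. B n) = (\<Sum>\<^sub>\<infinity>N. \<Sum>\<^sub>\<infinity>n. A (N - n) * B n)" .
  show "(\<lambda>N. \<Sum>\<^sub>\<infinity>n. A (N - n) * B n) summable_on UNIV"
    using summable_on_Sigma_banach[OF G] by simp
  show "(\<lambda>n. A (N - n) * B n) summable_on UNIV"
    using summable_on_SigmaD1[OF G, of N] by simp
qed

text \<open>Solving the recurrence downwards involves no division, and solving it upwards from the values at
  \<open>0\<close> and \<open>1\<close> divides by \<open>d k\<close> for positive \<open>k\<close> only. This matters because the relevant coefficient
  \<open>1 - q\<^bsup>-k\<^esup>\<close> does vanish at \<open>k = 0\<close>.\<close>

lemma three_term_recurrence_unique: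
  fixes A B :: "int \<Rightarrow> complex"
  assumes "\<And>k. c * A k = d k * A (k + 1) + A (k - 1)"
    and "\<And>k. c * B k = d k * B (k + 1) + B (k - 1)"
    and "\<And>k. 0 < k \<Longrightarrow> d k \<noteq> 0"
    and "A 0 = B 0" "A 1 = B 1"
  shows "A k = B k"
proof -
  have "A k = B k \<and> A (k + 1) = B (k + 1)"
  proof (induction k rule: int_induct[where k = 0])
    case base with assms show ?case by simp
  next
    case (step1 k)
    have "d (k + 1) * A (k + 1 + 1) = c * A (k + 1) - A k" "d (k + 1) * B (k + 1 + 1) = c * B (k + 1) - B k"
      using assms(1)[of "k + 1"] assms(2)[of "k + 1"] by simp_all
    with step1 have "d (k + 1) * A (k + 1 + 1) = d (k + 1) * B (k + 1 + 1)" by simp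
    moreover have "d (k + 1) \<noteq> 0" using step1 by (intro assms(3)) simp
    ultimately show ?case using step1 by auto
  next
    case (step2 k)
    have "A (k - 1) = c * A k - d k * A (k + 1)" "B (k - 1) = c * B k - d k * B (k + 1)"
      using assms(1)[of k] assms(2)[of k] by simp_all
    with step2 show ?case by simp
  qed
  then show ?thesis ..
qed

section \<open>Theta coefficients and the growth they dominate\<close>

locale punctured_unit_disc =
  fixes q :: complex
  assumes q_nonzero: "q \<noteq> 0" and norm_q_less_1: "norm q < 1"
begin

definition theta_coeff :: "int \<Rightarrow> complex" where
  "theta_coeff n = (-1) powi n * q powi (n * (n + 1) div 2)"

lemma theta_coeff_0 [simp]: "theta_coeff 0 = 1"
  by (simp add: theta_coeff_def)

lemma theta_coeff_Suc: "theta_coeff (n + 1) = - (q powi (n + 1) * theta_coeff n)"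
proof -
  have "(n + 1) * (n + 1 + 1) div 2 = n * (n + 1) div 2 + (n + 1)"
    by (simp add: algebra_simps)
  then show ?thesis
    by (simp add: theta_coeff_def power_int_add q_nonzero)
qed

lemma theta_coeff_minus: "theta_coeff (- n) = q powi (- n) * theta_coeff n"
proof -
  have "- n * (- n + 1) div 2 = n * (n + 1) div 2 - n"
    by (simp add: algebra_simps)
  moreover have "(-1 :: complex) powi (- n) = (-1) powi n"
    by (simp add: power_int_minus flip: power_int_inverse)
  ultimately show ?thesis
    by (simp add: theta_coeff_def power_int_diff power_int_minus q_nonzero divide_inverse)
qed

lemma norm_theta_coeff: "norm (theta_coeff n) = norm q ^ nat (n * (n + 1) div 2)"
proof -
  have "0 \<le> n * (n + 1)" by (cases "0 \<le> n") (auto intro: mult_nonpos_nonpos)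
  then have "0 \<le> n * (n + 1) div 2" by simp
  then show ?thesis
    by (simp add: theta_coeff_def norm_mult norm_power_int power_int_nonneg_exp norm_power)
qed

text \<open>As \<open>n (n + 1) / 2 \<ge> \<bar>n\<bar> (\<bar>n\<bar> - 1) / 2\<close>, it suffices to bound \<open>s\<^sub>n = (2 R)\<^sup>n \<bar>q\<bar>\<^bsup>n(n-1)/2\<^esup>\<close> for natural
  \<open>n\<close>. Its successive quotients \<open>2 R \<bar>q\<bar>\<^sup>n\<close> are below \<open>1\<close> from some index \<open>K\<close> on, and up to that index
  \<open>s\<^sub>n \<le> (2 R)\<^sup>K\<close>.\<close>

lemma theta_coeff_geometric_bound:
  assumes "1 \<le> R"
  obtains D where "\<And>n. norm (theta_coeff n) * R ^ nat \<bar>n\<bar> \<le> D * (1/2) ^ nat \<bar>n\<bar>"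
proof -
  (* The extra factor 2 ^ n leaves room for the geometric series with quotient 1/2. *)
  define s where "s n = (2 * R) ^ n * norm q ^ (n * (n - 1) div 2)" for n :: nat
  have "(\<lambda>n. 2 * R * norm q ^ n) \<longlonglongrightarrow> 2 * R * 0"
    using norm_q_less_1 by (intro tendsto_mult LIMSEQ_power_zero tendsto_const) auto
  then have "eventually (\<lambda>n. 2 * R * norm q ^ n < 1) sequentially"
    by (rule order_tendstoD(2)) simp
  then obtain K where K: "\<And>n. K \<le> n \<Longrightarrow> 2 * R * norm q ^ n < 1"
    by (auto simp: eventually_sequentially)
  have s_Suc: "s (Suc n) = s n * (2 * R * norm q ^ n)" for n
  proof -
    have "Suc n * (Suc n - 1) div 2 = n * (n - 1) div 2 + n"
      by (cases n) (auto simp: algebra_simps)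
    then show ?thesis by (simp add: s_def power_add algebra_simps del: diff_Suc_1)
  qed
  have s_nonneg: "0 \<le> s n" for n using assms by (simp add: s_def)
  have small: "s n \<le> (2 * R) ^ K" if "n \<le> K" for n
  proof -
    have "s n \<le> (2 * R) ^ n * 1"
      unfolding s_def using assms norm_q_less_1 by (intro mult_left_mono power_le_one) auto
    also have "\<dots> \<le> (2 * R) ^ K"
      unfolding mult_1_right using assms that by (intro power_increasing) auto
    finally show ?thesis .
  qed
  have s_le: "s n \<le> (2 * R) ^ K" for n
  proof (induction n)
    case 0 show ?case by (rule small) simp
  next
    case (Suc n)
    show ?case
    proof (cases "n < K")
      case True then show ?thesis by (intro small) simp
    next
      case False
      then have "s (Suc n) \<le> s n * 1"
        unfolding s_Suc using K[of n] by (intro mult_left_mono s_nonneg) auto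
      with Suc show ?thesis by simp
    qed
  qed
  have "norm (theta_coeff n) * R ^ nat \<bar>n\<bar> \<le> (2 * R) ^ K * (1/2) ^ nat \<bar>n\<bar>" for n
  proof -
    let ?m = "nat \<bar>n\<bar>"
    have "int (?m * (?m - 1) div 2) \<le> n * (n + 1) div 2"
    proof (cases "n = 0")
      case False
      then have "int (?m * (?m - 1)) = \<bar>n\<bar> * (\<bar>n\<bar> - 1)" by (simp add: of_nat_diff)
      also have "\<dots> \<le> n * (n + 1)" by (simp add: algebra_simps abs_if)
      finally show ?thesis by (simp add: zdiv_int zdiv_mono1)
    qed auto
    then have "?m * (?m - 1) div 2 \<le> nat (n * (n + 1) div 2)" by linarith
    then have "norm (theta_coeff n) \<le> norm q ^ (?m * (?m - 1) div 2)"
      unfolding norm_theta_coeff using norm_q_less_1 by (intro power_decreasing) auto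
    then have "norm (theta_coeff n) * R ^ ?m \<le> norm q ^ (?m * (?m - 1) div 2) * R ^ ?m"
      using assms by (intro mult_right_mono) auto
    also have "\<dots> = s ?m * (1/2) ^ ?m"
      by (simp add: s_def power_mult_distrib power_one_over)
    also have "\<dots> \<le> (2 * R) ^ K * (1/2) ^ ?m"
      by (intro mult_right_mono s_le) auto
    finally show ?thesis .
  qed
  then show thesis by (rule that)
qed

lemma theta_abs_summable:
  assumes "exp_bounded F"
  shows "(\<lambda>n. norm (theta_coeff n * F n)) summable_on UNIV"
proof -
  from assms obtain C R where
    F: "0 \<le> C" "1 \<le> R" "\<And>n. norm (F n) \<le> C * R ^ nat \<bar>n\<bar>"
    unfolding exp_bounded_def by blast
  obtain D where D: "\<And>n. norm (theta_coeff n) * R ^ nat \<bar>n\<bar> \<le> D * (1/2) ^ nat \<bar>n\<bar>"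
    using theta_coeff_geometric_bound[OF F(2)] by blast
  show ?thesis
  proof (rule Infinite_Sum.abs_summable_on_comparison_test')
    show "(\<lambda>n::int. C * (D * (1/2) ^ nat \<bar>n\<bar>)) summable_on UNIV"
      by (intro summable_on_cmult_right summable_on_geometric_int) auto
    fix n :: int
    have "norm (theta_coeff n * F n) \<le> norm (theta_coeff n) * (C * R ^ nat \<bar>n\<bar>)"
      unfolding norm_mult by (intro mult_left_mono F) auto
    also have "\<dots> = C * (norm (theta_coeff n) * R ^ nat \<bar>n\<bar>)" by simp
    also have "\<dots> \<le> C * (D * (1/2) ^ nat \<bar>n\<bar>)" by (intro mult_left_mono D F)
    finally show "norm (theta_coeff n * F n) \<le> C * (D * (1/2) ^ nat \<bar>n\<bar>)" .
  qed
qed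

lemma theta_summable: "exp_bounded F \<Longrightarrow> (\<lambda>n. theta_coeff n * F n) summable_on UNIV"
  by (rule Infinite_Sum.abs_summable_summable[OF theta_abs_summable])

section \<open>Infinite products and reciprocal q-factorials\<close>

lemma one_minus_q_power_nonzero: "0 < n \<Longrightarrow> 1 - q ^ n \<noteq> 0"
proof
  assume "0 < n" "1 - q ^ n = 0"
  then have "norm q ^ n = 1" by (simp flip: norm_power)
  moreover have "norm q ^ n < 1"
    using norm_q_less_1 \<open>0 < n\<close> by (simp add: power_less_one_iff)
  ultimately show False by simp
qed

lemma one_minus_q_powi_nonzero: "n \<noteq> 0 \<Longrightarrow> 1 - q powi n \<noteq> 0"
  using one_minus_q_power_nonzero[of "nat n"] one_minus_q_power_nonzero[of "nat (- n)"] q_nonzero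
  by (auto simp: power_int_def power_inverse field_simps split: if_splits)

lemma q_poch_convergent: "convergent_prod (\<lambda>j. 1 - x * q ^ j)"
proof (rule abs_convergent_prod_imp_convergent_prod, unfold abs_convergent_prod_conv_summable)
  have "summable (\<lambda>j. norm x * norm q ^ j)"
    using norm_q_less_1 by (intro summable_mult summable_geometric) auto
  then show "summable (\<lambda>j. norm (1 - x * q ^ j - 1))"
    by (simp add: norm_mult norm_power)
qed

lemma q_poch_inf_LIMSEQ: "(\<lambda>n. \<Prod>j<n. 1 - x * q ^ j) \<longlonglongrightarrow> q_poch_inf q x"
  unfolding q_poch_inf_def
  by (subst filterlim_sequentially_Suc[symmetric], unfold lessThan_Suc_atMost)
     (rule convergent_prod_LIMSEQ[OF q_poch_convergent])

lemma q_poch_inf_rec: "q_poch_inf q x = (1 - x) * q_poch_inf q (x * q)"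
proof (rule LIMSEQ_unique)
  show "(\<lambda>n. \<Prod>j<Suc n. 1 - x * q ^ j) \<longlonglongrightarrow> q_poch_inf q x"
    using q_poch_inf_LIMSEQ LIMSEQ_Suc by blast
  have "(\<Prod>j<Suc n. 1 - x * q ^ j) = (1 - x) * (\<Prod>j<n. 1 - x * q * q ^ j)" for n
    by (subst prod.lessThan_Suc_shift) (simp add: mult.assoc)
  then show "(\<lambda>n. \<Prod>j<Suc n. 1 - x * q ^ j) \<longlonglongrightarrow> (1 - x) * q_poch_inf q (x * q)"
    using tendsto_mult[OF tendsto_const q_poch_inf_LIMSEQ[of "x * q"], of "1 - x"] by simp
qed

lemma q_poch_inf_one [simp]: "q_poch_inf q 1 = 0"
  by (subst q_poch_inf_rec) simp

lemma q_poch_inf_nonzero: "(\<And>j. x * q ^ j \<noteq> 1) \<Longrightarrow> q_poch_inf q x \<noteq> 0"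
  unfolding q_poch_inf_def by (rule prodinf_nonzero[OF q_poch_convergent]) (metis eq_iff_diff_eq_0)

lemma q_poch_inf_q_nonzero [simp]: "q_poch_inf q q \<noteq> 0"
  by (rule q_poch_inf_nonzero)
    (use one_minus_q_power_nonzero[of "Suc _"] in \<open>auto simp: algebra_simps\<close>)

text \<open>The reciprocal \<open>1 / (q)\<^sub>m\<close>, continued by \<open>0\<close> to negative \<open>m\<close>. With this convention
  \<open>(1 - q\<^sup>m) / (q)\<^sub>m = 1 / (q)\<^bsub>m-1\<^esub>\<close> holds for all integers, so that finite sums can be written as sums over
  all integers and their index can be shifted without boundary terms.\<close>

definition recip_qfact :: "int \<Rightarrow> complex" where
  "recip_qfact m = (if m < 0 then 0 else 1 / (\<Prod>j<nat m. 1 - q ^ Suc j))"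

lemma recip_qfact_0 [simp]: "recip_qfact 0 = 1"
  by (simp add: recip_qfact_def)

lemma recip_qfact_neg [simp]: "m < 0 \<Longrightarrow> recip_qfact m = 0"
  by (simp add: recip_qfact_def)

lemma recip_qfact_rec: "(1 - q powi m) * recip_qfact m = recip_qfact (m - 1)"
proof (cases "0 < m")
  case True
  then obtain n where m: "m = int (Suc n)" by (metis pos_int_cases Suc_pred)
  have "nat (1 + int n) = Suc n" "1 - q * q ^ n \<noteq> 0"
    using one_minus_q_power_nonzero[of "Suc n"] by auto
  moreover have "q powi (1 + int n) = q * q ^ n"
    using q_nonzero by (simp add: power_int_add)
  ultimately show ?thesis by (simp add: m recip_qfact_def)
next
  case False
  then show ?thesis by (cases "m = 0") auto
qed

lemma recip_qfact_LIMSEQ: "(\<lambda>n. recip_qfact (int n)) \<longlonglongrightarrow> 1 / q_poch_inf q q"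
  using tendsto_divide[OF tendsto_const q_poch_inf_LIMSEQ[of q], of 1]
  by (simp add: recip_qfact_def)

lemma recip_qfact_bounded: obtains B where "\<And>m. norm (recip_qfact m) \<le> B"
proof -
  have "Bseq (\<lambda>n. recip_qfact (int n))"
    using recip_qfact_LIMSEQ by (intro convergent_imp_Bseq) (auto simp: convergent_def)
  then obtain B where B: "\<And>n. norm (recip_qfact (int n)) \<le> B"
    by (auto simp: Bseq_def)
  have "norm (recip_qfact m) \<le> B" for m
    using B[of "nat m"] B[of 0] norm_ge_zero[of "recip_qfact 0"] by (cases "m < 0") auto
  then show thesis by (rule that)
qed

lemma exp_bounded_recip_qfact: "exp_bounded recip_qfact"
  by (rule recip_qfact_bounded, rule exp_bounded_of_bounded)

text \<open>The weights \<open>1 / ((q)\<^bsub>N-j\<^esub> (q)\<^bsub>N+j\<^esub>)\<close> are bounded and tend to \<open>1 / (q)\<^sub>\<infinity>\<^sup>2\<close> for every \<open>j\<close>. This is the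
  passage from finite identities to identities of theta functions.\<close>

lemma tendsto_weighted_infsum:
  assumes "exp_bounded F"
  shows "(\<lambda>N. \<Sum>\<^sub>\<infinity>j. theta_coeff j * F j * (recip_qfact (int N - j) * recip_qfact (int N + j)))
           \<longlonglongrightarrow> (\<Sum>\<^sub>\<infinity>j. theta_coeff j * F j) / (q_poch_inf q q)\<^sup>2"
proof -
  let ?c = "1 / q_poch_inf q q"
  obtain B where B: "\<And>m. norm (recip_qfact m) \<le> B"
    using recip_qfact_bounded by blast
  have B0: "0 \<le> B" using B[of 0] norm_ge_zero order_trans by blast
  have lim: "(\<lambda>N. recip_qfact (int N + j)) \<longlonglongrightarrow> ?c" for j
  proof -
    have "filterlim (\<lambda>N. nat (int N + j)) at_top sequentially"
      unfolding filterlim_at_top eventually_sequentially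
    proof safe
      fix Z :: nat
      show "\<exists>N. \<forall>n\<ge>N. Z \<le> nat (int n + j)"
        by (intro exI[of _ "nat (int Z - j)"]) auto
    qed
    from filterlim_compose[OF recip_qfact_LIMSEQ this]
    have "(\<lambda>N. recip_qfact (int (nat (int N + j)))) \<longlonglongrightarrow> ?c" .
    moreover have "eventually (\<lambda>N. recip_qfact (int (nat (int N + j))) = recip_qfact (int N + j)) sequentially"
      by (rule eventually_sequentiallyI[of "nat (- j)"]) auto
    ultimately show ?thesis by (rule Lim_transform_eventually)
  qed
  have "(\<lambda>N. \<Sum>\<^sub>\<infinity>j. theta_coeff j * F j * (recip_qfact (int N - j) * recip_qfact (int N + j)))
      \<longlonglongrightarrow> (\<Sum>\<^sub>\<infinity>j. theta_coeff j * F j * (?c * ?c))"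
  proof (rule infsum_int_dominated_convergence)
    show "(\<lambda>N. theta_coeff j * F j * (recip_qfact (int N - j) * recip_qfact (int N + j)))
        \<longlonglongrightarrow> theta_coeff j * F j * (?c * ?c)" for j
      using lim[of "- j"] lim[of j] by (intro tendsto_mult tendsto_const) auto
    show "norm (theta_coeff j * F j * (recip_qfact (int N - j) * recip_qfact (int N + j)))
        \<le> norm (theta_coeff j * F j) * (B * B)" for N j
      unfolding norm_mult[of "theta_coeff j * F j"] norm_mult[of "recip_qfact _"]
      by (intro mult_left_mono mult_mono B B0) auto
    show "(\<lambda>j. norm (theta_coeff j * F j) * (B * B)) summable_on UNIV"
      by (intro summable_on_cmult_left theta_abs_summable assms)
  qed
  then show ?thesis unfolding infsum_cmult_left' by (simp add: power2_eq_square)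
qed

section \<open>The Jacobi triple product\<close>

text \<open>The theta series with its \<open>m\<close>-th term weighted by a q-binomial coefficient, up to the common factor
  \<open>(q)\<^bsub>a+b\<^esub>\<close>.\<close>

definition finite_theta :: "int \<Rightarrow> int \<Rightarrow> complex \<Rightarrow> complex" where
  "finite_theta a b y = (\<Sum>\<^sub>\<infinity>m. theta_coeff m * (y powi m * (recip_qfact (a - m) * recip_qfact (b + m))))"

lemma exp_bounded_weight: "exp_bounded (\<lambda>m. recip_qfact (a - m) * recip_qfact (b + m))"
  using exp_bounded_mult[OF exp_bounded_reflect[OF exp_bounded_recip_qfact, of a]
      exp_bounded_shift[OF exp_bounded_recip_qfact, of b]]
  by (simp add: add.commute)

lemma finite_theta_summable:
  "(\<lambda>m. theta_coeff m * (y powi m * (recip_qfact (a - m) * recip_qfact (b + m)))) summable_on UNIV"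
  by (intro theta_summable exp_bounded_mult exp_bounded_powi exp_bounded_weight)

text \<open>Multiply the \<open>m\<close>-th term by
  \<open>1 - q\<^bsup>a+1+b\<^esup> = (1 - q\<^bsup>a+1-m\<^esup>) + q\<^bsup>a+1-m\<^esup> (1 - q\<^bsup>b+m\<^esup>)\<close>. Each bracket lowers one of the two q-factorials;
  the sum arising from the second one becomes a multiple of the first after \<open>m \<mapsto> m + 1\<close>, because of
  \<open>t\<^sub>m\<^sub>+\<^sub>1 = - q\<^bsup>m+1\<^esup> t\<^sub>m\<close>.\<close>

lemma finite_theta_rec_left:
  assumes "y \<noteq> 0"
  shows "(1 - q powi (a + 1 + b)) * finite_theta (a + 1) b y = (1 - y * q powi (a + 1)) * finite_theta a b y"
proof -
  let ?f = "\<lambda>m. theta_coeff m * (y powi m * (recip_qfact (a - m) * recip_qfact (b + m)))"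
  let ?h = "\<lambda>m. q powi (a + 1 - m) * (theta_coeff m * (y powi m * (recip_qfact (a + 1 - m) * recip_qfact (b + m - 1))))"
  have split: "(1 - q powi (a + 1 + b)) * (theta_coeff m * (y powi m * (recip_qfact (a + 1 - m) * recip_qfact (b + m))))
      = ?f m + ?h m" for m
  proof -
    have "q powi (a + 1 + b) = q powi (a + 1 - m) * q powi (b + m)"
      using q_nonzero power_int_add[of q "a + 1 - m" "b + m"] by (simp add: algebra_simps)
    moreover have "recip_qfact (a - m) = (1 - q powi (a + 1 - m)) * recip_qfact (a + 1 - m)"
      by (simp add: recip_qfact_rec)
    moreover have "recip_qfact (b + m - 1) = (1 - q powi (b + m)) * recip_qfact (b + m)"
      by (simp add: recip_qfact_rec)
    ultimately show ?thesis by (simp only: ring_distribs mult_1_left mult_ac) simp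
  qed
  have shift: "?h (m + 1) = - (y * q powi (a + 1)) * ?f m" for m
  proof -
    have "q powi (a + 1) = q powi (a - m) * q powi (m + 1)"
      using q_nonzero power_int_add[of q "a - m" "m + 1"] by (simp add: algebra_simps)
    moreover have "recip_qfact (a + 1 - (m + 1)) = recip_qfact (a - m)" "q powi (a + 1 - (m + 1)) = q powi (a - m)"
      "recip_qfact (b + (m + 1) - 1) = recip_qfact (b + m)"
      by (simp_all add: algebra_simps)
    moreover have "y powi (m + 1) = y * y powi m"
      using assms by (simp add: power_int_add)
    ultimately show ?thesis by (simp only: theta_coeff_Suc) simp
  qed
  have f: "?f summable_on UNIV" by (rule finite_theta_summable)
  have "(\<lambda>m. ?h (m + 1)) summable_on UNIV"
    unfolding shift by (intro summable_on_cmult_right f)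
  then have h: "?h summable_on UNIV"
    by (subst (asm) summable_on_reindex_bij_betw[of "\<lambda>m. m + 1" UNIV UNIV])
      (auto intro!: bij_betw_byWitness[where f' = "\<lambda>m. m - 1"])
  have "(1 - q powi (a + 1 + b)) * finite_theta (a + 1) b y = infsum ?f UNIV + infsum ?h UNIV"
    unfolding finite_theta_def infsum_cmult_right'[symmetric] split by (rule infsum_add[OF f h])
  also have "infsum ?h UNIV = (\<Sum>\<^sub>\<infinity>m. ?h (m + 1))" by (rule infsum_int_shift[symmetric])
  also have "\<dots> = - (y * q powi (a + 1)) * infsum ?f UNIV"
    unfolding shift by (rule infsum_cmult_right')
  finally show ?thesis by (simp add: finite_theta_def algebra_simps)
qed

text \<open>The reflection \<open>m \<mapsto> - m\<close>. It turns the recurrence in the first index into one in the second.\<close>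

lemma finite_theta_swap:
  assumes "y \<noteq> 0"
  shows "finite_theta a b y = finite_theta b a (1 / (y * q))"
proof -
  have "finite_theta a b y = (\<Sum>\<^sub>\<infinity>m. theta_coeff (- m) * (y powi (- m) * (recip_qfact (a + m) * recip_qfact (b - m))))"
    unfolding finite_theta_def by (subst infsum_int_reflect[symmetric]) simp
  also have "\<dots> = finite_theta b a (1 / (y * q))"
    unfolding finite_theta_def
    by (intro infsum_cong)
      (simp add: theta_coeff_minus power_int_minus power_int_inverse power_int_mult_distrib divide_inverse)
  finally show ?thesis .
qed

lemma finite_theta_rec_right:
  assumes "y \<noteq> 0"
  shows "(1 - q powi (a + (b + 1))) * finite_theta a (b + 1) y = (1 - q powi b / y) * finite_theta a b y"
  using finite_theta_rec_left[of "1 / (y * q)" b a] assms q_nonzero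
  by (simp add: finite_theta_swap[of y] power_int_add add_ac)

lemma finite_theta_00: "finite_theta 0 0 y = 1"
proof -
  have "finite_theta 0 0 y = (\<Sum>\<^sub>\<infinity>m\<in>{0::int}. 1)"
    unfolding finite_theta_def
    by (rule infsum_cong_neutral) (auto simp: recip_qfact_def)
  then show ?thesis by simp
qed

lemma finite_jacobi_triple_product:
  assumes "y \<noteq> 0"
  shows "finite_theta (int a) (int b) y =
    (\<Prod>l<a. 1 - y * q * q ^ l) * (\<Prod>l<b. 1 - 1 / y * q ^ l) * recip_qfact (int a + int b)"
proof (induction b)
  case 0
  show ?case
  proof (induction a)
    case 0 show ?case by (simp add: finite_theta_00)
  next
    case (Suc a)
    have "(1 - q powi (int a + 1)) * finite_theta (int a + 1) 0 y
        = (1 - y * q powi (int a + 1)) * finite_theta (int a) 0 y"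
      using finite_theta_rec_left[OF assms, of "int a" 0] by simp
    also have "\<dots> = (1 - q powi (int a + 1)) * ((\<Prod>l<Suc a. 1 - y * q * q ^ l) * recip_qfact (int a + 1))"
    proof -
      have "y * q powi (int a + 1) = y * q * q ^ a"
        using q_nonzero by (simp add: power_int_add)
      moreover have "recip_qfact (int a) = (1 - q powi (int a + 1)) * recip_qfact (int a + 1)"
        using recip_qfact_rec[of "int a + 1"] by simp
      ultimately show ?thesis using Suc by simp
    qed
    finally show ?case
      using one_minus_q_powi_nonzero[of "int a + 1"] by (simp add: add.commute)
  qed
next
  case (Suc b)
  have "(1 - q powi (int a + (int b + 1))) * finite_theta (int a) (int b + 1) y
      = (1 - q powi (int b) / y) * finite_theta (int a) (int b) y"
    by (rule finite_theta_rec_right[OF assms])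
  also have "\<dots> = (1 - q powi (int a + (int b + 1))) *
      ((\<Prod>l<a. 1 - y * q * q ^ l) * (\<Prod>l<Suc b. 1 - 1 / y * q ^ l) * recip_qfact (int a + (int b + 1)))"
  proof -
    have "recip_qfact (int a + int b)
        = (1 - q powi (int a + (int b + 1))) * recip_qfact (int a + (int b + 1))"
      using recip_qfact_rec[of "int a + (int b + 1)"] by simp
    then show ?thesis using Suc by simp
  qed
  finally show ?case
    using one_minus_q_powi_nonzero[of "int a + (int b + 1)"] by (simp add: add_ac)
qed

text \<open>On the product side \<open>y = 1\<close> is a zero of the factor \<open>1 - 1 / y\<close>, and \<open>y = 1 / q\<close> in the next lemma one of
  \<open>1 - y q\<close>. These two zeros remove the polynomial parts from the partial fractions below.\<close>

lemma finite_theta_one: "finite_theta (int a) (int b + 1) 1 = 0"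
  using finite_jacobi_triple_product[of 1 a "Suc b"]
  by (simp add: prod.lessThan_Suc_shift add.commute del: prod.lessThan_Suc)

lemma finite_theta_inverse_q: "finite_theta (int a + 1) (int b) (1 / q) = 0"
  using finite_jacobi_triple_product[of "1 / q" "Suc a" b] q_nonzero
  by (simp add: prod.lessThan_Suc_shift add.commute del: prod.lessThan_Suc)

definition theta_sum :: "complex \<Rightarrow> complex" where
  "theta_sum y = (\<Sum>\<^sub>\<infinity>n. theta_coeff n * y powi n)"

text \<open>The limit of the finite version for \<open>a = b = N\<close>, \<open>N \<rightarrow> \<infinity>\<close>.\<close>

theorem jacobi_triple_product:
  assumes "y \<noteq> 0"
  shows "theta_sum y = q_poch_inf q q * q_poch_inf q (y * q) * q_poch_inf q (1 / y)"
proof -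
  have "(\<lambda>N. finite_theta (int N) (int N) y) \<longlonglongrightarrow> theta_sum y / (q_poch_inf q q)\<^sup>2"
    using tendsto_weighted_infsum[OF exp_bounded_powi[of y]]
    by (simp add: finite_theta_def theta_sum_def mult.assoc)
  moreover have "(\<lambda>N. finite_theta (int N) (int N) y)
      \<longlonglongrightarrow> q_poch_inf q (y * q) * q_poch_inf q (1 / y) * (1 / q_poch_inf q q)"
  proof -
    have "filterlim (\<lambda>N::nat. N + N) at_top sequentially"
      by (rule filterlim_subseq) (auto simp: strict_mono_def)
    from filterlim_compose[OF recip_qfact_LIMSEQ this]
    have "(\<lambda>N. recip_qfact (int N + int N)) \<longlonglongrightarrow> 1 / q_poch_inf q q"
      by simp
    then show ?thesis
      unfolding finite_jacobi_triple_product[OF assms]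
      by (intro tendsto_mult q_poch_inf_LIMSEQ)
  qed
  ultimately have "theta_sum y / (q_poch_inf q q)\<^sup>2
      = q_poch_inf q (y * q) * q_poch_inf q (1 / y) * (1 / q_poch_inf q q)"
    by (rule LIMSEQ_unique)
  then show ?thesis by (simp add: field_simps power2_eq_square)
qed

lemma theta_sum_one [simp]: "theta_sum 1 = 0"
  by (subst jacobi_triple_product) auto

lemma theta_sum_nonzero:
  assumes "y \<noteq> 0" "\<And>m::int. y * q powi m \<noteq> 1"
  shows "theta_sum y \<noteq> 0"
proof -
  have "y * q * q ^ j \<noteq> 1" for j
    using assms(2)[of "int j + 1"] q_nonzero by (simp add: power_int_add algebra_simps)
  moreover have "1 / y * q ^ j \<noteq> 1" for j
    using assms(2)[of "- int j"] assms(1) q_nonzero by (auto simp: power_int_minus field_simps)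
  ultimately show ?thesis
    by (simp add: jacobi_triple_product assms(1) q_poch_inf_nonzero)
qed

lemma theta_sum_shift:
  assumes "y \<noteq> 0"
  shows "theta_sum (y * q) = - theta_sum y / (y * q)"
proof -
  have "theta_sum y = (\<Sum>\<^sub>\<infinity>n. theta_coeff (n + 1) * y powi (n + 1))"
    unfolding theta_sum_def using infsum_int_shift[of "\<lambda>n. theta_coeff n * y powi n" 1] by simp
  also have "\<dots> = (\<Sum>\<^sub>\<infinity>n. (- (y * q)) * (theta_coeff n * (y * q) powi n))"
    using assms q_nonzero
    by (intro infsum_cong) (simp add: theta_coeff_Suc power_int_add power_int_mult_distrib)
  also have "\<dots> = - (y * q) * theta_sum (y * q)"
    unfolding theta_sum_def by (rule infsum_cmult_right')
  finally show ?thesis using assms q_nonzero by (simp add: field_simps)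
qed

lemma theta_sum_inverse:
  assumes "y \<noteq> 0"
  shows "theta_sum (1 / y) = - y * theta_sum y"
proof -
  have "theta_sum (1 / y) = (\<Sum>\<^sub>\<infinity>n. theta_coeff (- n) * (1 / y) powi (- n))"
    unfolding theta_sum_def using infsum_int_reflect[of "\<lambda>n. theta_coeff n * (1 / y) powi n"] by simp
  also have "\<dots> = theta_sum (y / q)"
    unfolding theta_sum_def
    by (intro infsum_cong)
      (simp add: theta_coeff_minus power_int_minus_divide power_int_divide_distrib power_int_one_over)
  also have "\<dots> = - y * theta_sum y"
    using theta_sum_shift[of "y / q"] assms q_nonzero by (simp add: field_simps)
  finally show ?thesis .
qed

section \<open>Partial fractions of q-Pochhammer symbols\<close>

text \<open>For \<open>x = exp (2 \<pi> \<i> u)\<close> the excluded points are those with \<open>u\<close> in the period lattice. They are the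
  zeros of the denominators \<open>1 - x q\<^sup>m\<close> and, by the triple product, those of the theta series.\<close>

definition off_spiral :: "complex \<Rightarrow> bool" where
  "off_spiral x \<longleftrightarrow> x \<noteq> 0 \<and> (\<forall>m::int. x * q powi m \<noteq> 1)"

lemma off_spiral_nonzero: "off_spiral x \<Longrightarrow> x \<noteq> 0"
  by (simp add: off_spiral_def)

lemma off_spiral_denominator: "off_spiral x \<Longrightarrow> 1 - x * q powi m \<noteq> 0"
  by (simp add: off_spiral_def)

lemma off_spiral_shift: "off_spiral x \<Longrightarrow> off_spiral (x * q powi k)"
  using q_nonzero unfolding off_spiral_def
  by (auto simp: mult.assoc simp flip: power_int_add)

lemma off_spiral_shift': "off_spiral x \<Longrightarrow> off_spiral (x * q)" "off_spiral x \<Longrightarrow> off_spiral (x / q)"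
  using off_spiral_shift[of x 1] off_spiral_shift[of x "-1"] by (simp_all add: power_int_minus divide_inverse)

lemma off_spiral_inverse: "off_spiral x \<Longrightarrow> off_spiral (1 / x)"
  unfolding off_spiral_def
proof (elim conjE, intro conjI allI)
  fix m :: int
  assume "x \<noteq> 0" "\<forall>m::int. x * q powi m \<noteq> 1"
  from this(2)[rule_format, of "- m"] show "1 / x * q powi m \<noteq> 1"
    using \<open>x \<noteq> 0\<close> q_nonzero by (auto simp: power_int_minus field_simps)
qed auto

lemma theta_sum_off_spiral: "off_spiral y \<Longrightarrow> theta_sum y \<noteq> 0"
  by (rule theta_sum_nonzero) (auto simp: off_spiral_def)

text \<open>The sequence is even bounded: it tends to \<open>1\<close> as \<open>n \<rightarrow> \<infinity>\<close>, to \<open>0\<close> as \<open>n \<rightarrow> - \<infinity>\<close>, and no denominator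
  vanishes.\<close>

lemma exp_bounded_pole:
  assumes "off_spiral x"
  shows "exp_bounded (\<lambda>n. 1 / (1 - x * q powi n))"
proof -
  have x: "x \<noteq> 0" by (rule off_spiral_nonzero[OF assms])
  have lim: "(\<lambda>n. z * q ^ n) \<longlonglongrightarrow> 0" for z
    using tendsto_mult[OF tendsto_const LIMSEQ_power_zero[OF norm_q_less_1], of z] by simp
  have "(\<lambda>n. 1 / (1 - x * q ^ n)) \<longlonglongrightarrow> 1 / (1 - 0)"
    by (intro tendsto_divide tendsto_diff tendsto_const lim) simp
  then have "Bseq (\<lambda>n. 1 / (1 - x * q ^ n))"
    by (intro convergent_imp_Bseq) (auto simp: convergent_def)
  then obtain B1 where B1: "\<And>n. norm (1 / (1 - x * q ^ n)) \<le> B1"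
    by (auto simp: Bseq_def)
  (* For negative indices, 1 / (1 - x / Q) = (Q / x) / (Q / x - 1) with Q a positive power of q. *)
  have "(\<lambda>n. inverse x * q ^ n / (inverse x * q ^ n - 1)) \<longlonglongrightarrow> 0 / (0 - 1)"
    by (intro tendsto_divide tendsto_diff tendsto_const lim) simp
  then have "Bseq (\<lambda>n. inverse x * q ^ n / (inverse x * q ^ n - 1))"
    by (intro convergent_imp_Bseq) (auto simp: convergent_def)
  then obtain B2 where B2: "\<And>n. norm (inverse x * q ^ n / (inverse x * q ^ n - 1)) \<le> B2"
    by (auto simp: Bseq_def)
  show ?thesis
  proof (rule exp_bounded_of_bounded)
    fix n :: int
    show "norm (1 / (1 - x * q powi n)) \<le> max B1 B2"
    proof (cases "0 \<le> n")
      case True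
      then show ?thesis using B1[of "nat n"] by (simp add: power_int_nonneg_exp)
    next
      case False
      define k where "k = nat (- n)"
      have n: "q powi n = inverse (q ^ k)"
        using False q_nonzero by (simp add: k_def power_int_def power_inverse)
      have "1 - x * q powi n \<noteq> 0" by (rule off_spiral_denominator[OF assms])
      then have "x \<noteq> q ^ k" unfolding n using q_nonzero by (auto simp: field_simps)
      then have "1 / (1 - x * q powi n) = inverse x * q ^ k / (inverse x * q ^ k - 1)"
        unfolding n using x q_nonzero by (simp add: field_simps)
      then show ?thesis using B2[of k] by simp
    qed
  qed
qed

text \<open>The weights of the finite theta sum, now attached to the simple poles \<open>x = q\<^bsup>-j\<^esup>\<close>: a partial fraction
  expansion in \<open>x\<close>.\<close>

definition finite_lerch :: "int \<Rightarrow> int \<Rightarrow> complex \<Rightarrow> complex" where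
  "finite_lerch a b x =
     (\<Sum>\<^sub>\<infinity>j. theta_coeff j * (1 / (1 - x * q powi j) * (recip_qfact (a - j) * recip_qfact (b + j))))"

lemma finite_lerch_summable:
  assumes "off_spiral x"
  shows "(\<lambda>j. theta_coeff j * (1 / (1 - x * q powi j) * (recip_qfact (a - j) * recip_qfact (b + j)))) summable_on UNIV"
  by (intro theta_summable exp_bounded_mult exp_bounded_pole exp_bounded_weight assms)

text \<open>Multiply the \<open>j\<close>-th term by
  \<open>1 - x q\<^bsup>a+1\<^esup> = (1 - q\<^bsup>a+1-j\<^esup>) + q\<^bsup>a+1-j\<^esup> (1 - x q\<^sup>j)\<close>. The first bracket lowers a q-factorial; the second
  one cancels the pole and leaves a finite theta sum at \<open>y = 1 / q\<close>, which is zero.\<close>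

lemma finite_lerch_rec_left:
  assumes "off_spiral x" "0 \<le> a" "0 \<le> b"
  shows "(1 - x * q powi (a + 1)) * finite_lerch (a + 1) b x = finite_lerch a b x"
proof -
  let ?f = "\<lambda>j. theta_coeff j * (1 / (1 - x * q powi j) * (recip_qfact (a - j) * recip_qfact (b + j)))"
  let ?h = "\<lambda>j. theta_coeff j * ((1 / q) powi j * (recip_qfact (a + 1 - j) * recip_qfact (b + j)))"
  (* Here q powi (a + 1) * ?h j = q powi (a + 1 - j) times the weights: hence the argument 1 / q. *)
  have split: "(1 - x * q powi (a + 1)) *
      (theta_coeff j * (1 / (1 - x * q powi j) * (recip_qfact (a + 1 - j) * recip_qfact (b + j))))
      = ?f j + q powi (a + 1) * ?h j" for j
  proof -
    have "q powi (a + 1) * (1 / q) powi j = q powi (a + 1 - j)"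
      using q_nonzero by (simp add: power_int_diff power_int_one_over)
    then have h: "q powi (a + 1) * ?h j =
        theta_coeff j * (q powi (a + 1 - j) * (recip_qfact (a + 1 - j) * recip_qfact (b + j)))"
      by (metis (no_types, lifting) mult.left_commute mult.assoc)
    have f: "recip_qfact (a - j) = (1 - q powi (a + 1 - j)) * recip_qfact (a + 1 - j)"
      by (simp add: recip_qfact_rec)
    have "q powi (a + 1) = q powi (a + 1 - j) * q powi j"
      using q_nonzero power_int_add[of q "a + 1 - j" j] by simp
    then show ?thesis
      unfolding h f using off_spiral_denominator[OF assms(1), of j]
      by (simp add: divide_simps) (simp add: algebra_simps)
  qed
  have f: "?f summable_on UNIV" by (rule finite_lerch_summable[OF assms(1)])
  have h: "(\<lambda>j. q powi (a + 1) * ?h j) summable_on UNIV"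
    by (intro summable_on_cmult_right finite_theta_summable)
  have "finite_theta (a + 1) b (1 / q) = 0"
    using finite_theta_inverse_q[of "nat a" "nat b"] assms(2,3) by simp
  then have zero: "infsum (\<lambda>j. q powi (a + 1) * ?h j) UNIV = 0"
    unfolding infsum_cmult_right' by (simp add: finite_theta_def)
  have "(1 - x * q powi (a + 1)) * finite_lerch (a + 1) b x
      = infsum ?f UNIV + infsum (\<lambda>j. q powi (a + 1) * ?h j) UNIV"
    unfolding finite_lerch_def infsum_cmult_right'[symmetric] split by (rule infsum_add[OF f h])
  then show ?thesis by (simp only: zero add_0_right finite_lerch_def)
qed

text \<open>Here the factor is split as
  \<open>1 - q\<^bsup>b+1\<^esup> / x = (1 - q\<^bsup>b+1+j\<^esup>) + q\<^bsup>b+1+j\<^esup> (1 - q\<^bsup>-j\<^esup> / x)\<close>, and the terms without a pole form a finite theta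
  sum at \<open>y = 1\<close>.\<close>

lemma finite_lerch_rec_right:
  assumes "off_spiral x" "0 \<le> a" "0 \<le> b"
  shows "(1 - q powi (b + 1) / x) * finite_lerch a (b + 1) x = finite_lerch a b x"
proof -
  let ?f = "\<lambda>j. theta_coeff j * (1 / (1 - x * q powi j) * (recip_qfact (a - j) * recip_qfact (b + j)))"
  let ?h = "\<lambda>j. theta_coeff j * (1 powi j * (recip_qfact (a - j) * recip_qfact (b + 1 + j)))"
  have x: "x \<noteq> 0" by (rule off_spiral_nonzero[OF assms(1)])
  have split: "(1 - q powi (b + 1) / x) *
      (theta_coeff j * (1 / (1 - x * q powi j) * (recip_qfact (a - j) * recip_qfact (b + 1 + j))))
      = ?f j + (- (q powi (b + 1) / x)) * ?h j" for j
  proof -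
    have f: "recip_qfact (b + j) = (1 - q powi (b + 1 + j)) * recip_qfact (b + 1 + j)"
      using recip_qfact_rec[of "b + 1 + j"] by simp
    have "q powi (b + 1 + j) = q powi (b + 1) * q powi j"
      using q_nonzero by (rule power_int_add[OF disjI1])
    then show ?thesis
      unfolding f using off_spiral_denominator[OF assms(1), of j] x
      by (simp add: divide_simps) (simp add: algebra_simps)
  qed
  have f: "?f summable_on UNIV" by (rule finite_lerch_summable[OF assms(1)])
  have h: "(\<lambda>j. (- (q powi (b + 1) / x)) * ?h j) summable_on UNIV"
    by (intro summable_on_cmult_right finite_theta_summable)
  have "finite_theta a (b + 1) 1 = 0"
    using finite_theta_one[of "nat a" "nat b"] assms(2,3) by simp
  then have zero: "infsum (\<lambda>j. (- (q powi (b + 1) / x)) * ?h j) UNIV = 0"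
    unfolding infsum_cmult_right' by (simp add: finite_theta_def)
  have "(1 - q powi (b + 1) / x) * finite_lerch a (b + 1) x
      = infsum ?f UNIV + infsum (\<lambda>j. (- (q powi (b + 1) / x)) * ?h j) UNIV"
    unfolding finite_lerch_def infsum_cmult_right'[symmetric] split by (rule infsum_add[OF f h])
  then show ?thesis by (simp only: zero add_0_right finite_lerch_def)
qed

lemma finite_lerch_00: "finite_lerch 0 0 x = 1 / (1 - x)"
proof -
  have "finite_lerch 0 0 x = (\<Sum>\<^sub>\<infinity>m\<in>{0::int}. 1 / (1 - x))"
    unfolding finite_lerch_def
    by (rule infsum_cong_neutral) (auto simp: recip_qfact_def)
  then show ?thesis by simp
qed

text \<open>A finite form of the partial fraction expansion of the reciprocal of the theta series, obtained by
  multiplying in one linear factor at a time.\<close>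

lemma finite_lerch_product:
  assumes "off_spiral x"
  shows "finite_lerch (int a) (int b) x = 1 / ((\<Prod>l<Suc a. 1 - x * q ^ l) * (\<Prod>l<b. 1 - q / x * q ^ l))"
proof (induction b)
  case 0
  show ?case
  proof (induction a)
    case 0 show ?case by (simp add: finite_lerch_00)
  next
    case (Suc a)
    have q: "q powi (int a + 1) = q ^ Suc a"
      using q_nonzero by (simp add: power_int_add)
    have "1 - x * q ^ Suc a \<noteq> 0"
      using off_spiral_denominator[OF assms, of "int (Suc a)"] by (simp del: of_nat_Suc power_Suc)
    moreover have "(1 - x * q ^ Suc a) * finite_lerch (int a + 1) 0 x = finite_lerch (int a) 0 x"
      using finite_lerch_rec_left[OF assms, of "int a" 0] unfolding q by simp
    ultimately have "finite_lerch (int a + 1) 0 x = finite_lerch (int a) 0 x / (1 - x * q ^ Suc a)"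
      by (simp add: field_simps)
    with Suc show ?case
      unfolding prod.lessThan_Suc[of _ "Suc a"] by (simp add: add.commute mult.commute)
  qed
next
  case (Suc b)
  have "x * q powi (- (int b + 1)) \<noteq> 1" using assms unfolding off_spiral_def by blast
  then have "x \<noteq> q powi (int b + 1)"
    unfolding power_int_minus using q_nonzero by auto
  then have "1 - q powi (int b + 1) / x \<noteq> 0"
    using off_spiral_nonzero[OF assms] by (simp add: field_simps)
  moreover have q: "q powi (int b + 1) / x = q / x * q ^ b"
    using q_nonzero by (simp add: power_int_add)
  ultimately have nz: "1 - q / x * q ^ b \<noteq> 0" by simp
  have "(1 - q / x * q ^ b) * finite_lerch (int a) (int b + 1) x = finite_lerch (int a) (int b) x"
    using finite_lerch_rec_right[OF assms, of "int a" "int b"] unfolding q by simp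
  with nz have "finite_lerch (int a) (int b + 1) x = finite_lerch (int a) (int b) x / (1 - q / x * q ^ b)"
    by (simp add: field_simps)
  with Suc show ?case
    unfolding prod.lessThan_Suc[of _ b] by (simp add: add.commute mult.assoc)
qed

text \<open>The case \<open>b = 0\<close>, in which only the poles of one q-Pochhammer symbol occur.\<close>

lemma partial_fractions_q_poch:
  assumes "off_spiral x"
  shows "1 / (\<Prod>l<Suc a. 1 - x * q ^ l) =
    (\<Sum>j\<le>a. theta_coeff (int j) * recip_qfact (int a - int j) * recip_qfact (int j) / (1 - x * q ^ j))"
proof -
  have "1 / (\<Prod>l<Suc a. 1 - x * q ^ l) = finite_lerch (int a) 0 x"
    using finite_lerch_product[OF assms, of a 0] by simp
  also have "\<dots> = (\<Sum>\<^sub>\<infinity>j\<in>int ` {..a}. theta_coeff j * (1 / (1 - x * q powi j) * (recip_qfact (int a - j) * recip_qfact (0 + j))))"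
    unfolding finite_lerch_def
  proof (rule infsum_cong_neutral)
    fix j :: int
    assume "j \<in> UNIV - int ` {..a}"
    then have "j < 0 \<or> int a < j" by (auto simp: image_iff) (metis atMost_iff nat_int nat_le_iff not_le int_nat_eq)
    then show "theta_coeff j * (1 / (1 - x * q powi j) * (recip_qfact (int a - j) * recip_qfact (0 + j))) = 0"
      by auto
  qed auto
  also have "\<dots> = (\<Sum>j\<le>a. theta_coeff (int j) * recip_qfact (int a - int j) * recip_qfact (int j) / (1 - x * q ^ j))"
    by (simp add: sum.reindex mult.assoc)
  finally show ?thesis .
qed

section \<open>The Appell-Lerch series and its contiguous relations\<close>

text \<open>For \<open>x = exp (2 \<pi> \<i> u)\<close>, \<open>y = exp (2 \<pi> \<i> v)\<close> this is the series defining \<open>\<mu>(u, v; k)\<close> with the factor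
  \<open>exp (\<pi> \<i> v)\<close>, common to all terms, removed.\<close>

definition appell_lerch :: "int \<Rightarrow> complex \<Rightarrow> complex \<Rightarrow> complex" where
  "appell_lerch k x y = (\<Sum>\<^sub>\<infinity>n. theta_coeff n * (y powi n *
     (q_poch_inf q (x * q powi (n + 1)) / q_poch_inf q (x * q powi (n - k + 1)))))"

lemma q_poch_inf_off_spiral: "off_spiral x \<Longrightarrow> q_poch_inf q x \<noteq> 0"
proof (rule q_poch_inf_nonzero)
  fix j assume "off_spiral x"
  then have "x * q powi (int j) \<noteq> 1" unfolding off_spiral_def by blast
  then show "x * q ^ j \<noteq> 1" by simp
qed

text \<open>For integral \<open>k\<close> this quotient is a rational function. The summand of index \<open>n\<close> contains its value at
  \<open>x q\<^sup>n\<close>.\<close>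

definition mu_factor :: "int \<Rightarrow> complex \<Rightarrow> complex" where
  "mu_factor k x = q_poch_inf q (x * q) / q_poch_inf q (x * q powi (1 - k))"

lemma appell_lerch_eq:
  "appell_lerch k x y = (\<Sum>\<^sub>\<infinity>n. theta_coeff n * (y powi n * mu_factor k (x * q powi n)))"
proof -
  have eq: "x * q powi n * q = x * q powi (n + 1)"
    "x * q powi n * q powi (1 - k) = x * q powi (n - k + 1)" for n
    using q_nonzero power_int_add[of q n 1] power_int_add[of q n "1 - k"] by (simp_all add: algebra_simps)
  show ?thesis unfolding appell_lerch_def mu_factor_def eq ..
qed

lemma mu_factor_0: "off_spiral x \<Longrightarrow> mu_factor 0 x = 1"
  by (simp add: mu_factor_def q_poch_inf_off_spiral off_spiral_shift')

lemma mu_factor_pred: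
  assumes "off_spiral x"
  shows "mu_factor (k - 1) x = (1 - x * q powi (1 - k)) * mu_factor k x"
proof -
  have "q_poch_inf q (x * q powi (1 - k)) = (1 - x * q powi (1 - k)) * q_poch_inf q (x * q powi (1 - (k - 1)))"
  proof -
    have "q powi (1 - k) * q = q powi (1 - (k - 1))"
      using q_nonzero power_int_add[of q "1 - k" 1] by (simp add: algebra_simps)
    then show ?thesis using q_poch_inf_rec[of "x * q powi (1 - k)"] by (simp add: mult.assoc)
  qed
  then show ?thesis
    using off_spiral_denominator[OF assms, of "1 - k"] by (simp add: mu_factor_def)
qed

lemma mu_factor_div:
  assumes "off_spiral x"
  shows "mu_factor k (x / q) = (1 - x) * mu_factor (k + 1) x"
proof -
  have "x / q * q powi (1 - k) = x * q powi (1 - (k + 1))"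
    using q_nonzero power_int_diff[of q "1 - k" 1] by simp
  then show ?thesis
    using q_nonzero q_poch_inf_rec[of x] by (simp add: mu_factor_def)
qed

lemma mu_factor_1: "off_spiral x \<Longrightarrow> mu_factor 1 x = 1 / (1 - x)"
  using mu_factor_pred[of x 1] mu_factor_0[of x] off_spiral_denominator[of x 0] by (simp add: field_simps)

lemma mu_factor_nat:
  assumes "off_spiral x"
  shows "mu_factor (int k) x = (\<Prod>l<k. 1 / (1 - x * q powi (- int l)))"
proof (induction k)
  case 0 then show ?case by (simp add: mu_factor_0 assms)
next
  case (Suc k)
  have "mu_factor (int k) x = (1 - x * q powi (- int k)) * mu_factor (int (Suc k)) x"
    using mu_factor_pred[OF assms, of "int (Suc k)"] by simp
  with Suc off_spiral_denominator[OF assms, of "- int k"] show ?case by (simp add: field_simps)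
qed

text \<open>Raising \<open>k\<close> by one introduces a factor \<open>1 / (1 - x' q\<^sup>n)\<close>, lowering it a linear polynomial in \<open>q\<^sup>n\<close>; the
  growth class admits both.\<close>

lemma exp_bounded_mu_factor:
  assumes "off_spiral x"
  shows "exp_bounded (\<lambda>n. mu_factor k (x * q powi n))"
proof (induction k rule: int_induct[where k = 0])
  case base
  show ?case
    by (rule exp_bounded_cong[OF exp_bounded_const[of 1]]) (simp add: mu_factor_0 off_spiral_shift assms)
next
  case (step1 k)
  have "exp_bounded (\<lambda>n. 1 / (1 - x * q powi (- k) * q powi n) * mu_factor k (x * q powi n))"
    by (intro exp_bounded_mult exp_bounded_pole off_spiral_shift assms step1)
  then show ?case
  proof (rule exp_bounded_cong)
    fix n
    have "1 - x * q powi n * q powi (- k) \<noteq> 0"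
      by (rule off_spiral_denominator[OF off_spiral_shift[OF assms]])
    moreover have "mu_factor k (x * q powi n) = (1 - x * q powi n * q powi (- k)) * mu_factor (k + 1) (x * q powi n)"
      using mu_factor_pred[OF off_spiral_shift[OF assms], of "k + 1" n] by simp
    ultimately show "mu_factor (k + 1) (x * q powi n)
        = 1 / (1 - x * q powi (- k) * q powi n) * mu_factor k (x * q powi n)"
      by (simp add: mult.commute mult.left_commute)
  qed
next
  case (step2 k)
  have "exp_bounded (\<lambda>n. (1 + (- x * q powi (1 - k)) * q powi n) * mu_factor k (x * q powi n))"
    by (intro exp_bounded_mult exp_bounded_add exp_bounded_const exp_bounded_powi step2)
  then show ?case
    by (rule exp_bounded_cong) (simp add: mu_factor_pred[OF off_spiral_shift[OF assms]] algebra_simps)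
qed

lemma appell_lerch_summable:
  assumes "off_spiral x"
  shows "(\<lambda>n. theta_coeff n * (y powi n * mu_factor k (x * q powi n))) summable_on UNIV"
  by (intro theta_summable exp_bounded_mult exp_bounded_powi exp_bounded_mu_factor assms)

lemma appell_lerch_0:
  assumes "off_spiral x"
  shows "appell_lerch 0 x y = theta_sum y"
  by (simp add: appell_lerch_eq theta_sum_def mu_factor_0 off_spiral_shift assms)

lemma appell_lerch_1:
  assumes "off_spiral x"
  shows "appell_lerch 1 x y = (\<Sum>\<^sub>\<infinity>n. theta_coeff n * (y powi n * (1 / (1 - x * q powi n))))"
  by (simp add: appell_lerch_eq mu_factor_1 off_spiral_shift assms)

text \<open>With \<open>F\<^sub>k = mu_factor k\<close> one has \<open>F\<^bsub>k-1\<^esub>(X) = (1 - X q) F\<^sub>k(X q)\<close> at \<open>X = x q\<^sup>n\<close>. The part with the factor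
  \<open>X q = x q\<^bsup>n+1\<^esup>\<close> is a multiple of the term of index \<open>n + 1\<close> of the original series, because
  \<open>t\<^sub>n\<^sub>+\<^sub>1 = - q\<^bsup>n+1\<^esup> t\<^sub>n\<close>.\<close>

lemma appell_lerch_q_mult:
  assumes "off_spiral x" "y \<noteq> 0"
  shows "appell_lerch k (x * q) y = appell_lerch (k - 1) x y - x / y * appell_lerch k x y"
proof -
  let ?g = "\<lambda>n. theta_coeff n * (y powi n * mu_factor k (x * q * q powi n))"
  let ?h = "\<lambda>n. theta_coeff n * (y powi n * mu_factor k (x * q powi n))"
  have g: "?g summable_on UNIV"
    by (intro appell_lerch_summable off_spiral_shift' assms)
  have h: "(\<lambda>n. ?h (n + 1)) summable_on UNIV"
    by (intro summable_on_reindex_bij_betw[of "\<lambda>n. n + 1" UNIV UNIV, THEN iffD2]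
        appell_lerch_summable assms bij_betw_byWitness[where f' = "\<lambda>m. m - 1"]) auto
  have "theta_coeff n * (y powi n * mu_factor (k - 1) (x * q powi n)) = ?g n + x / y * ?h (n + 1)" for n
  proof -
    have eq: "x * q powi (n + 1) = x * q * q powi n" "y powi (n + 1) = y * y powi n"
      using q_nonzero assms(2) by (simp_all add: power_int_add)
    have r: "mu_factor (k - 1) (x * q powi n) = (1 - x * q powi (n + 1)) * mu_factor k (x * q powi (n + 1))"
      using mu_factor_div[OF off_spiral_shift[OF assms(1)], of "k - 1" "n + 1"] q_nonzero
      by (simp add: power_int_add)
    have t: "theta_coeff (n + 1) = - (q * q powi n * theta_coeff n)"
      using q_nonzero by (simp add: theta_coeff_Suc power_int_add)
    show ?thesis
      unfolding r t eq using assms(2) by (simp add: algebra_simps)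
  qed
  then have "appell_lerch (k - 1) x y = infsum ?g UNIV + x / y * (\<Sum>\<^sub>\<infinity>n. ?h (n + 1))"
    unfolding appell_lerch_eq infsum_cmult_right'[symmetric]
    by (simp only: infsum_add[OF g summable_on_cmult_right[OF h]])
  also have "(\<Sum>\<^sub>\<infinity>n. ?h (n + 1)) = infsum ?h UNIV"
    by (rule infsum_int_shift)
  finally show ?thesis by (simp add: appell_lerch_eq)
qed

text \<open>Termwise: \<open>F\<^sub>k(X / q)\<close> and \<open>F\<^sub>k(X)\<close> are \<open>F\<^sub>k\<^sub>+\<^sub>1(X)\<close> times \<open>1 - X\<close> and \<open>1 - X q\<^bsup>-k\<^esup>\<close>, and
  \<open>1 - X = q\<^sup>k (1 - X q\<^bsup>-k\<^esup>) + (1 - q\<^sup>k)\<close>.\<close>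

lemma appell_lerch_q_div:
  assumes "off_spiral x"
  shows "appell_lerch k (x / q) y = q powi k * appell_lerch k x y + (1 - q powi k) * appell_lerch (k + 1) x y"
proof -
  have "theta_coeff n * (y powi n * mu_factor k (x / q * q powi n)) =
      q powi k * (theta_coeff n * (y powi n * mu_factor k (x * q powi n)))
      + (1 - q powi k) * (theta_coeff n * (y powi n * mu_factor (k + 1) (x * q powi n)))" for n
  proof -
    have 1: "mu_factor k (x / q * q powi n) = (1 - x * q powi n) * mu_factor (k + 1) (x * q powi n)"
      using mu_factor_div[OF off_spiral_shift[OF assms], of k n] by (simp add: field_simps)
    have 2: "mu_factor k (x * q powi n) = (1 - x * q powi n * q powi (- k)) * mu_factor (k + 1) (x * q powi n)"
      using mu_factor_pred[OF off_spiral_shift[OF assms], of "k + 1" n] by simp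
    have "q powi k * q powi (- k) = 1" using q_nonzero by (simp add: power_int_minus)
    then have 3: "q powi k * ((1 - x * q powi n * q powi (- k)) * r) = (q powi k - x * q powi n) * r" for r
      by (simp add: algebra_simps)
    have "q powi k * (theta_coeff n * (y powi n * mu_factor k (x * q powi n)))
        = theta_coeff n * (y powi n * ((q powi k - x * q powi n) * mu_factor (k + 1) (x * q powi n)))"
      unfolding 2 3[symmetric] by (simp only: mult_ac)
    then show ?thesis unfolding 1 by (simp add: algebra_simps)
  qed
  then show ?thesis
    unfolding appell_lerch_eq infsum_cmult_right'[symmetric]
    by (simp only: infsum_add[OF summable_on_cmult_right summable_on_cmult_right] appell_lerch_summable assms)
qed

text \<open>The relation for multiplication by \<open>q\<close> is applied at \<open>x / q\<close>, and the two shifted series in it are removed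
  with the relation for division by \<open>q\<close>, at the indices \<open>k - 1\<close> and \<open>k\<close>.\<close>

lemma appell_lerch_three_term:
  assumes "off_spiral x" "y \<noteq> 0"
  shows "(1 + x / y) * appell_lerch k x y =
    appell_lerch (k - 1) x y + x / y * (1 - q powi (- k)) * appell_lerch (k + 1) x y"
proof -
  let ?S = "\<lambda>k. appell_lerch k x y"
  define Q where "Q = q powi k"
  have Q: "Q \<noteq> 0" "q powi (k - 1) = Q / q" "q powi (- k) = 1 / Q"
    using q_nonzero by (simp_all add: Q_def power_int_diff power_int_minus_divide)
  define X where "X = x / y"
  have X: "x / q / y = X / q" and xq: "x / q * q = x" using q_nonzero by (simp_all add: X_def)
  have "?S k = appell_lerch (k - 1) (x / q) y - X / q * appell_lerch k (x / q) y"
    using appell_lerch_q_mult[OF off_spiral_shift'(2)[OF assms(1)] assms(2), of k]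
    unfolding X xq .
  also have "\<dots> = Q / q * ?S (k - 1) + (1 - Q / q) * ?S k - X / q * (Q * ?S k + (1 - Q) * ?S (k + 1))"
    using appell_lerch_q_div[OF assms(1), of "k - 1" y] appell_lerch_q_div[OF assms(1), of k y]
    by (simp add: Q Q_def[symmetric])
  (* Q / q is q powi (k - 1). After multiplication by q, the term q * ?S k on both sides cancels. *)
  finally have S: "?S k = Q / q * ?S (k - 1) + (1 - Q / q) * ?S k - X / q * (Q * ?S k + (1 - Q) * ?S (k + 1))" .
  have "q * ?S k = Q * ?S (k - 1) + (q - Q) * ?S k - X * (Q * ?S k + (1 - Q) * ?S (k + 1))"
    by (subst S) (use q_nonzero in \<open>simp add: field_simps\<close>)
  then have "Q * ?S k = Q * ?S (k - 1) - X * (Q * ?S k + (1 - Q) * ?S (k + 1))"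
    by (simp add: algebra_simps)
  then have "Q * ((1 + X) * ?S k) = Q * (?S (k - 1) + X * (1 - 1 / Q) * ?S (k + 1))"
    using Q(1) by (simp add: algebra_simps)
  then show ?thesis using Q by (simp add: X_def)
qed

text \<open>The rational factor at \<open>X\<close> is the reciprocal of a q-Pochhammer symbol at \<open>X q\<^bsup>-a\<^esup>\<close>, so its partial fractions
  are known; each of them contributes a series with a single simple pole per term.\<close>

lemma appell_lerch_partial_fractions:
  assumes "off_spiral x"
  shows "appell_lerch (int (Suc a)) x y =
    (\<Sum>j\<le>a. theta_coeff (int a - int j) * recip_qfact (int j) * recip_qfact (int a - int j)
      * appell_lerch 1 (x * q powi (- int j)) y)"
proof -
  let ?c = "\<lambda>j. theta_coeff (int a - int j) * recip_qfact (int j) * recip_qfact (int a - int j)"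
  have off: "off_spiral (x * q powi m)" for m by (rule off_spiral_shift[OF assms])
  have mu_factor: "mu_factor (int (Suc a)) (x * q powi n) =
      (\<Sum>j\<le>a. ?c j * (1 / (1 - x * q powi (- int j) * q powi n)))" for n
  proof -
    let ?X = "x * q powi n * q powi (- int a)"
    have "mu_factor (int (Suc a)) (x * q powi n) = 1 / (\<Prod>l<Suc a. 1 - x * q powi n * q powi (- int l))"
      unfolding mu_factor_nat[OF off] by (simp only: prod_dividef prod.neutral_const)
    also have "(\<Prod>l<Suc a. 1 - x * q powi n * q powi (- int l)) = (\<Prod>l<Suc a. 1 - ?X * q ^ l)"
    proof (rule prod.reindex_bij_witness[where i = "\<lambda>l. a - l" and j = "\<lambda>l. a - l"])
      fix l assume "l \<in> {..<Suc a}"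
      then have "q powi (- int a + int (a - l)) = q powi (- int l)" by (simp add: of_nat_diff)
      then have "q powi (- int a) * q ^ (a - l) = q powi (- int l)"
        using q_nonzero power_int_add[of q "- int a" "int (a - l)"] by (simp del: of_nat_diff)
      then show "1 - ?X * q ^ (a - l) = 1 - x * q powi n * q powi (- int l)"
        by (simp add: mult.assoc)
    qed auto
    also have "1 / (\<Prod>l<Suc a. 1 - ?X * q ^ l) =
        (\<Sum>m\<le>a. theta_coeff (int m) * recip_qfact (int a - int m) * recip_qfact (int m) / (1 - ?X * q ^ m))"
      by (rule partial_fractions_q_poch) (intro off_spiral_shift off)
    also have "\<dots> = (\<Sum>j\<le>a. ?c j * (1 / (1 - x * q powi (- int j) * q powi n)))"
    proof (rule sum.reindex_bij_witness[where i = "\<lambda>l. a - l" and j = "\<lambda>l. a - l"])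
      fix m assume "m \<in> {..a}"
      then have m: "int (a - m) = int a - int m" by (simp add: of_nat_diff)
      have "q powi (- int a) * q ^ m = q powi (- int (a - m))"
        unfolding m using q_nonzero power_int_add[of q "- int a" "int m"] by simp
      then have denominator: "1 - x * q powi (- int (a - m)) * q powi n = 1 - ?X * q ^ m"
        by (simp only: mult_ac)
      show "?c (a - m) * (1 / (1 - x * q powi (- int (a - m)) * q powi n))
          = theta_coeff (int m) * recip_qfact (int a - int m) * recip_qfact (int m) / (1 - ?X * q ^ m)"
        unfolding denominator unfolding m by simp
    qed auto
    finally show ?thesis .
  qed
  have "appell_lerch (int (Suc a)) x y =
      (\<Sum>\<^sub>\<infinity>n. \<Sum>j\<le>a. ?c j * (theta_coeff n * (y powi n * (1 / (1 - x * q powi (- int j) * q powi n)))))"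
    unfolding appell_lerch_eq mu_factor by (simp add: sum_distrib_left mult_ac)
  also have "\<dots> = (\<Sum>j\<le>a. \<Sum>\<^sub>\<infinity>n. ?c j * (theta_coeff n * (y powi n * (1 / (1 - x * q powi (- int j) * q powi n)))))"
    by (intro infsum_finite_sum finite_atMost summable_on_cmult_right theta_summable exp_bounded_mult exp_bounded_powi
        exp_bounded_pole off)
  also have "\<dots> = (\<Sum>j\<le>a. ?c j * appell_lerch 1 (x * q powi (- int j)) y)"
    by (simp only: infsum_cmult_right' appell_lerch_1[OF off])
  finally show ?thesis .
qed

section \<open>Translation and reflection of the first Appell-Lerch series\<close>

text \<open>The classical partial fraction expansion of the reciprocal of a theta function, as the limit of its
  finite form; the triple product identifies the resulting product with the theta series.\<close>

lemma reciprocal_theta_expansion: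
  assumes "off_spiral x"
  shows "appell_lerch 1 x 1 = - (q_poch_inf q q ^ 3) / (x * theta_sum x)"
proof -
  have x: "x \<noteq> 0" by (rule off_spiral_nonzero[OF assms])
  have nz: "q_poch_inf q x \<noteq> 0" "q_poch_inf q (q / x) \<noteq> 0"
    using q_poch_inf_off_spiral[OF assms]
      q_poch_inf_off_spiral[OF off_spiral_shift'(1)[OF off_spiral_inverse[OF assms]]] by simp_all
  have "(\<lambda>N. finite_lerch (int N) (int N) x) \<longlonglongrightarrow> appell_lerch 1 x 1 / (q_poch_inf q q)\<^sup>2"
    using tendsto_weighted_infsum[OF exp_bounded_pole[OF assms]]
    by (simp add: finite_lerch_def appell_lerch_1[OF assms] mult.assoc)
  moreover have "(\<lambda>N. finite_lerch (int N) (int N) x) \<longlonglongrightarrow> 1 / (q_poch_inf q x * q_poch_inf q (q / x))"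
    unfolding finite_lerch_product[OF assms]
    by (intro tendsto_divide tendsto_mult tendsto_const q_poch_inf_LIMSEQ LIMSEQ_Suc[OF q_poch_inf_LIMSEQ])
      (use nz in auto)
  ultimately have 1: "appell_lerch 1 x 1 / (q_poch_inf q q)\<^sup>2 = 1 / (q_poch_inf q x * q_poch_inf q (q / x))"
    by (rule LIMSEQ_unique)
  have e1: "q_poch_inf q x = (1 - x) * q_poch_inf q (x * q)" by (rule q_poch_inf_rec)
  have e2: "q_poch_inf q (1 / x) = (1 - 1 / x) * q_poch_inf q (q / x)"
    using q_poch_inf_rec[of "1 / x"] by simp
  have "x * theta_sum x = - (q_poch_inf q q * q_poch_inf q x * q_poch_inf q (q / x))"
    unfolding jacobi_triple_product[OF x] e1 e2 using x by (simp add: field_simps)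
  with 1 nz show ?thesis
    using off_spiral_denominator[OF assms, of 0] by (simp add: field_simps power2_eq_square power3_eq_cube)
qed

lemma theta_abs_summable_powi: "(\<lambda>n. norm (theta_coeff n * y powi n)) summable_on UNIV"
  by (intro theta_abs_summable exp_bounded_powi)

lemma lerch_abs_summable:
  "off_spiral x \<Longrightarrow> (\<lambda>n. norm (theta_coeff n * (y powi n * (1 / (1 - x * q powi n))))) summable_on UNIV"
  by (intro theta_abs_summable exp_bounded_mult exp_bounded_powi exp_bounded_pole)

text \<open>Here \<open>A N\<close> is the coefficient of \<open>y\<^sup>N\<close> in \<open>theta_sum y * appell_lerch 1 x (y * z)\<close>. Since
  \<open>t\<^bsub>N+1-n\<^esub> = - q\<^bsup>N+1-n\<^esup> t\<^bsub>N-n\<^esub>\<close>, the two summands on the left combine to a term with the factor \<open>1 - x q\<^sup>n\<close>, which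
  cancels the denominator.\<close>

lemma theta_times_lerch_coeff_rec:
  assumes "off_spiral x" "z \<noteq> 0"
  defines "A \<equiv> \<lambda>N. \<Sum>\<^sub>\<infinity>n. theta_coeff (N - n) * (theta_coeff n * (z powi n * (1 / (1 - x * q powi n))))"
  shows "A (N + 1) + x * q powi (N + 1) * A N =
    - (q powi (N + 1)) * (\<Sum>\<^sub>\<infinity>n. theta_coeff (N - n) * (theta_coeff n * (z / q) powi n))"
proof -
  let ?L = "\<lambda>n. theta_coeff n * (z powi n * (1 / (1 - x * q powi n)))"
  have summable: "(\<lambda>n. theta_coeff (N - n) * ?L n) summable_on UNIV" for N
    using infsum_product_diagonal(3)[OF theta_abs_summable_powi[of 1] lerch_abs_summable[OF assms(1)]] by simp
  have "theta_coeff (N + 1 - n) * ?L n + x * q powi (N + 1) * (theta_coeff (N - n) * ?L n)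
      = - (q powi (N + 1)) * (theta_coeff (N - n) * (theta_coeff n * (z / q) powi n))" for n
  proof -
    have t: "theta_coeff (N + 1 - n) = - (q powi (N + 1) / q powi n * theta_coeff (N - n))"
      using theta_coeff_Suc[of "N - n"] q_nonzero power_int_diff[of q "N + 1" n] by (simp add: algebra_simps)
    show ?thesis
      unfolding t power_int_divide_distrib
      using off_spiral_denominator[OF assms(1), of n] q_nonzero
      by (simp add: divide_simps) (simp add: algebra_simps)
  qed
  then have "(\<Sum>\<^sub>\<infinity>n. theta_coeff (N + 1 - n) * ?L n + x * q powi (N + 1) * (theta_coeff (N - n) * ?L n))
      = (\<Sum>\<^sub>\<infinity>n. - (q powi (N + 1)) * (theta_coeff (N - n) * (theta_coeff n * (z / q) powi n)))"
    by simp
  also have "(\<Sum>\<^sub>\<infinity>n. theta_coeff (N + 1 - n) * ?L n + x * q powi (N + 1) * (theta_coeff (N - n) * ?L n))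
      = A (N + 1) + (\<Sum>\<^sub>\<infinity>n. x * q powi (N + 1) * (theta_coeff (N - n) * ?L n))"
    unfolding A_def by (rule infsum_add[OF summable summable_on_cmult_right[OF summable]])
  finally show ?thesis by (simp only: A_def infsum_cmult_right')
qed

text \<open>The reflection \<open>n \<mapsto> N + 1 - n\<close>. It shows that the inhomogeneous terms of the recurrences for the two
  halves of the translation formula agree.\<close>

lemma theta_convolution_scale:
  assumes "z \<noteq> 0"
  shows "(\<Sum>\<^sub>\<infinity>n. theta_coeff (N - n) * (theta_coeff n * (z / q) powi n))
    = z powi (N + 1) * (\<Sum>\<^sub>\<infinity>n. theta_coeff (N - n) * (theta_coeff n * (1 / z / q) powi n))"
proof -
  have "(\<Sum>\<^sub>\<infinity>n. theta_coeff (N - n) * (theta_coeff n * (z / q) powi n))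
    = (\<Sum>\<^sub>\<infinity>n. z powi (N + 1) * (theta_coeff (N - n) * (theta_coeff n * (1 / z / q) powi n)))"
  proof (rule infsum_reindex_bij_witness[where j = "\<lambda>n. N + 1 - n" and i = "\<lambda>n. N + 1 - n"])
    fix n :: int
    have t: "theta_coeff n = - (q powi n * theta_coeff (n - 1))" for n
      using theta_coeff_Suc[of "n - 1"] by simp
    have t': "theta_coeff (N + 1 - n) = - (q powi (N + 1 - n) * theta_coeff (N - n))"
      using t[of "N + 1 - n"] by (simp add: algebra_simps)
    have "z powi (N + 1) * (1 / z) powi (N + 1 - n) = z powi n"
      using assms by (simp add: power_int_diff power_int_one_over)
    then have z: "z powi (N + 1) * ((1 / z / q) powi (N + 1 - n) * c) = z powi n / q powi (N + 1 - n) * c" for c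
      unfolding power_int_divide_distrib[of "1 / z" q] by (simp add: mult.assoc[symmetric])
    have "z powi (N + 1) * (theta_coeff (N - (N + 1 - n)) * (theta_coeff (N + 1 - n) * (1 / z / q) powi (N + 1 - n)))
      = z powi (N + 1) * ((1 / z / q) powi (N + 1 - n) * (theta_coeff (n - 1) * theta_coeff (N + 1 - n)))"
      by (simp add: algebra_simps)
    also have "\<dots> = z powi n / q powi (N + 1 - n) * (theta_coeff (n - 1) * theta_coeff (N + 1 - n))"
      by (rule z)
    also have "\<dots> = - (z powi n * theta_coeff (n - 1) * theta_coeff (N - n))"
      unfolding t' using q_nonzero by simp
    also have "\<dots> = theta_coeff (N - n) * (theta_coeff n * (z / q) powi n)"
      unfolding t[of n] using q_nonzero by (simp add: power_int_divide_distrib)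
    finally show "z powi (N + 1) * (theta_coeff (N - (N + 1 - n)) * (theta_coeff (N + 1 - n) * (1 / z / q) powi (N + 1 - n)))
      = theta_coeff (N - n) * (theta_coeff n * (z / q) powi n)" .
  qed auto
  then show ?thesis by (simp only: infsum_cmult_right')
qed

text \<open>The left side is a Laurent series in \<open>y\<close>. Its coefficients \<open>a N\<close> satisfy the homogeneous first-order
  recurrence of those of \<open>theta_sum (x * y * z)\<close>, so the two series are proportional. At \<open>y = 1\<close> the first
  product on the left vanishes and the second is a reciprocal theta function; this determines the factor.\<close>

lemma appell_lerch_translation:
  assumes x: "off_spiral x" and xz: "off_spiral (x * z)" and "y \<noteq> 0" "z \<noteq> 0"
  shows "theta_sum y * appell_lerch 1 (x * z) (y * z) - theta_sum (y * z) * appell_lerch 1 x y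
    = q_poch_inf q q ^ 3 * theta_sum z * theta_sum (x * y * z) / (x * theta_sum x * theta_sum (x * z))"
proof -
  have x0: "x \<noteq> 0" using x by (rule off_spiral_nonzero)
  (* The products on the left have the coefficients A N and z powi N * B N; the second one is the first
     with x * z, z replaced by x, 1 / z, up to the scaling of y by z. *)
  define A where "A N = (\<Sum>\<^sub>\<infinity>n. theta_coeff (N - n) * (theta_coeff n * (z powi n * (1 / (1 - x * z * q powi n)))))" for N
  define B where "B N = (\<Sum>\<^sub>\<infinity>n. theta_coeff (N - n) * (theta_coeff n * ((1 / z) powi n * (1 / (1 - x * q powi n)))))" for N
  define a where "a N = A N - z powi N * B N" for N
  have rec: "a (N + 1) = - (x * z * q powi (N + 1)) * a N" for N
  proof -
    have 1: "A (N + 1) + x * z * q powi (N + 1) * A N =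
      - (q powi (N + 1)) * (\<Sum>\<^sub>\<infinity>n. theta_coeff (N - n) * (theta_coeff n * (z / q) powi n))"
      unfolding A_def by (rule theta_times_lerch_coeff_rec[OF xz \<open>z \<noteq> 0\<close>])
    have 2: "B (N + 1) + x * q powi (N + 1) * B N =
      - (q powi (N + 1)) * (\<Sum>\<^sub>\<infinity>n. theta_coeff (N - n) * (theta_coeff n * (1 / z / q) powi n))"
      unfolding B_def using x \<open>z \<noteq> 0\<close> by (intro theta_times_lerch_coeff_rec) auto
    have "A (N + 1) + x * z * q powi (N + 1) * A N = z powi (N + 1) * (B (N + 1) + x * q powi (N + 1) * B N)"
      unfolding 1 2 theta_convolution_scale[OF \<open>z \<noteq> 0\<close>] by simp
    moreover have "z powi (N + 1) = z * z powi N" using \<open>z \<noteq> 0\<close> by (simp add: power_int_add)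
    ultimately show ?thesis by (simp add: a_def algebra_simps)
  qed
  have a: "a N = a 0 * (theta_coeff N * (x * z) powi N)" for N
  proof (induction N rule: int_induct[where k = 0])
    case base show ?case by simp
  next
    case (step1 N)
    then show ?case using x0 \<open>z \<noteq> 0\<close> by (simp add: rec theta_coeff_Suc power_int_add)
  next
    case (step2 N)
    have 1: "a N = - (x * z * q powi N) * a (N - 1)" using rec[of "N - 1"] by simp
    have 2: "theta_coeff N = - (q powi N * theta_coeff (N - 1))" using theta_coeff_Suc[of "N - 1"] by simp
    have "- (x * z * q powi N) * a (N - 1) = - (x * z * q powi N) * (a 0 * (theta_coeff (N - 1) * (x * z) powi (N - 1)))"
      using step2 x0 \<open>z \<noteq> 0\<close> unfolding 1[symmetric] 2 by (simp add: power_int_diff)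
    then show ?case using x0 \<open>z \<noteq> 0\<close> q_nonzero by simp
  qed
  have series: "theta_sum y * appell_lerch 1 (x * z) (y * z) - theta_sum (y * z) * appell_lerch 1 x y
      = a 0 * theta_sum (x * y * z)" if "y \<noteq> 0" for y
  proof -
    note prod1 = infsum_product_diagonal[OF theta_abs_summable_powi[of y] lerch_abs_summable[OF xz, of "y * z"]]
    note prod2 = infsum_product_diagonal[OF theta_abs_summable_powi[of "y * z"] lerch_abs_summable[OF x, of y]]
    have c1: "(\<Sum>\<^sub>\<infinity>n. theta_coeff (N - n) * y powi (N - n) * (theta_coeff n * ((y * z) powi n * (1 / (1 - x * z * q powi n)))))
        = y powi N * A N" for N
      unfolding A_def infsum_cmult_right'[symmetric]
      using that by (intro infsum_cong) (simp add: power_int_diff power_int_mult_distrib)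
    have c2: "(\<Sum>\<^sub>\<infinity>n. theta_coeff (N - n) * (y * z) powi (N - n) * (theta_coeff n * (y powi n * (1 / (1 - x * q powi n)))))
        = y powi N * (z powi N * B N)" for N
      unfolding B_def infsum_cmult_right'[symmetric]
      using that \<open>z \<noteq> 0\<close>
      by (intro infsum_cong) (simp add: power_int_diff power_int_mult_distrib power_int_one_over)
    have "theta_sum y * appell_lerch 1 (x * z) (y * z) = (\<Sum>\<^sub>\<infinity>N. y powi N * A N)"
      unfolding theta_sum_def appell_lerch_1[OF xz] prod1(1) c1 ..
    moreover have "theta_sum (y * z) * appell_lerch 1 x y = (\<Sum>\<^sub>\<infinity>N. y powi N * (z powi N * B N))"
      unfolding theta_sum_def appell_lerch_1[OF x] prod2(1) c2 ..
    moreover have "(\<Sum>\<^sub>\<infinity>N. y powi N * A N + - (y powi N * (z powi N * B N)))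
        = (\<Sum>\<^sub>\<infinity>N. y powi N * A N) + (\<Sum>\<^sub>\<infinity>N. - (y powi N * (z powi N * B N)))"
      using prod1(2) prod2(2) unfolding c1 c2 by (intro infsum_add summable_on_uminus[THEN iffD2])
    moreover have "y powi N * A N + - (y powi N * (z powi N * B N)) = a 0 * (theta_coeff N * (x * y * z) powi N)" for N
    proof -
      have "y powi N * A N + - (y powi N * (z powi N * B N)) = y powi N * a N"
        by (simp add: a_def algebra_simps)
      then show ?thesis unfolding a[of N] by (simp add: power_int_mult_distrib)
    qed
    ultimately show ?thesis
      by (simp only: infsum_uminus infsum_cmult_right' theta_sum_def) simp
  qed
  have nz: "theta_sum (x * z) \<noteq> 0" by (rule theta_sum_off_spiral[OF xz])
  (* theta_sum 1 = 0 leaves only the second product on the left. *)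
  have "a 0 * theta_sum (x * z) = q_poch_inf q q ^ 3 * theta_sum z / (x * theta_sum x)"
    using series[of 1, symmetric] by (simp add: reciprocal_theta_expansion[OF x] mult.commute)
  then have "a 0 = q_poch_inf q q ^ 3 * theta_sum z / (x * theta_sum x * theta_sum (x * z))"
    using nz x0 theta_sum_off_spiral[OF x] by (simp add: field_simps)
  then show ?thesis using series[OF \<open>y \<noteq> 0\<close>] by simp
qed

text \<open>The reflection \<open>n \<mapsto> - n\<close>, together with \<open>1 / (1 - 1 / X) = - X / (1 - X)\<close>.\<close>

lemma appell_lerch_inverse:
  assumes "off_spiral x"
  shows "appell_lerch 1 (1 / x) (1 / y) = - x * appell_lerch 1 x y"
proof -
  have x: "x \<noteq> 0" by (rule off_spiral_nonzero[OF assms])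
  let ?f = "\<lambda>n. theta_coeff n * ((1 / y) powi n * (1 / (1 - 1 / x * q powi n)))"
  have "appell_lerch 1 (1 / x) (1 / y) = (\<Sum>\<^sub>\<infinity>n. ?f (- n))"
    unfolding appell_lerch_1[OF off_spiral_inverse[OF assms]] infsum_int_reflect[of ?f] ..
  also have "\<dots> = (\<Sum>\<^sub>\<infinity>n. - x * (theta_coeff n * (y powi n * (1 / (1 - x * q powi n)))))"
  proof (rule infsum_cong)
    fix n :: int
    define Q where "Q = q powi n"
    have Q: "Q \<noteq> 0" "1 - x * Q \<noteq> 0"
      using q_nonzero off_spiral_denominator[OF assms] by (auto simp: Q_def)
    have e1: "1 - 1 / x * q powi (- n) = - (1 - x * Q) / (x * Q)"
      using Q(1) x by (simp add: power_int_minus_divide Q_def[symmetric] field_simps)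
    have e2: "(1 / y) powi (- n) = y powi n"
      by (simp add: power_int_minus_divide power_int_one_over)
    have e3: "theta_coeff (- n) = theta_coeff n / Q"
      by (simp add: theta_coeff_minus power_int_minus_divide Q_def)
    show "?f (- n) = - x * (theta_coeff n * (y powi n * (1 / (1 - x * q powi n))))"
      unfolding e1 e2 e3 Q_def[symmetric] using Q x by (simp add: divide_simps) (simp add: algebra_simps)
  qed
  also have "\<dots> = - x * appell_lerch 1 x y"
    unfolding appell_lerch_1[OF assms] by (rule infsum_cmult_right')
  finally show ?thesis .
qed

section \<open>Rogers-Szego polynomials\<close>

text \<open>This is \<open>1 / (p; p)\<^sub>m\<close> for the inverse base \<open>p = 1 / q\<close>, again continued by \<open>0\<close>; the theta coefficient comes
  from \<open>1 - p\<^sup>j = - p\<^sup>j (1 - q\<^sup>j)\<close>.\<close>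

definition recip_qfact_inv :: "int \<Rightarrow> complex" where
  "recip_qfact_inv m = theta_coeff m * recip_qfact m"

lemma recip_qfact_inv_rec: "(1 - q powi (- m)) * recip_qfact_inv m = recip_qfact_inv (m - 1)"
proof -
  have t: "theta_coeff m = - (q powi m * theta_coeff (m - 1))"
    using theta_coeff_Suc[of "m - 1"] by simp
  have "(1 - q powi (- m)) * recip_qfact_inv m = theta_coeff (m - 1) * ((1 - q powi m) * recip_qfact m)"
    unfolding recip_qfact_inv_def t using q_nonzero by (simp add: power_int_minus field_simps)
  then show ?thesis by (simp add: recip_qfact_rec recip_qfact_inv_def)
qed

text \<open>In base \<open>p = 1 / q\<close>, this is the \<open>k\<close>-th Rogers-Szego polynomial at \<open>w\<^sup>2\<close> divided by \<open>w\<^sup>k (p; p)\<^sub>k\<close>, in other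
  words the continuous q-Hermite polynomial at \<open>(w + 1 / w) / 2\<close> divided by \<open>(p; p)\<^sub>k\<close>.\<close>

definition rogers_szego :: "int \<Rightarrow> complex \<Rightarrow> complex" where
  "rogers_szego k w = (\<Sum>\<^sub>\<infinity>n. recip_qfact_inv (k - n) * (recip_qfact_inv n * w powi (2 * n - k)))"

lemma rogers_szego_as_sum:
  "rogers_szego k w = (\<Sum>n\<in>{0..k}. recip_qfact_inv (k - n) * (recip_qfact_inv n * w powi (2 * n - k)))"
proof -
  have "rogers_szego k w = (\<Sum>\<^sub>\<infinity>n\<in>{0..k}. recip_qfact_inv (k - n) * (recip_qfact_inv n * w powi (2 * n - k)))"
    unfolding rogers_szego_def by (rule infsum_cong_neutral) (auto simp: recip_qfact_inv_def)
  then show ?thesis by simp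
qed

lemma rogers_szego_neg: "k < 0 \<Longrightarrow> rogers_szego k w = 0"
  by (simp add: rogers_szego_as_sum)

lemma rogers_szego_0: "rogers_szego 0 w = 1"
  by (simp add: rogers_szego_as_sum recip_qfact_inv_def)

lemma rogers_szego_summable:
  "(\<lambda>n. recip_qfact_inv (k - n) * (recip_qfact_inv (n - j) * w powi (2 * n - l))) summable_on UNIV"
  by (rule finite_nonzero_values_imp_summable_on, rule finite_subset[of _ "{j..k}"])
    (auto simp: recip_qfact_inv_def recip_qfact_def split: if_splits)

text \<open>The splitting \<open>1 - p\<^bsup>k+1\<^esup> = (1 - p\<^sup>n) + p\<^sup>n (1 - p\<^bsup>k+1-n\<^esup>)\<close> lowers one of the two factorials in base
  \<open>p = 1 / q\<close>, and \<open>p\<^sup>n / (p; p)\<^sub>n = 1 / (p; p)\<^sub>n - 1 / (p; p)\<^bsub>n-1\<^esub>\<close> removes the remaining power of \<open>p\<close>.\<close>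

lemma rogers_szego_recurrence:
  assumes "w \<noteq> 0"
  shows "(w + 1 / w) * rogers_szego k w = (1 - q powi (- (k + 1))) * rogers_szego (k + 1) w + rogers_szego (k - 1) w"
proof -
  let ?s = recip_qfact_inv
  have s: "?s (k + 1 - n - 1) = ?s (k - n)" for n
    by (simp add: algebra_simps)
  have f1: "(\<lambda>n. ?s (k + 1 - n) * (?s (n - 1) * w powi (2 * n - (k + 1)))) summable_on UNIV"
    by (rule rogers_szego_summable)
  have f2: "(\<lambda>n. 1 / w * (?s (k - n) * (?s (n - 0) * w powi (2 * n - k)))) summable_on UNIV"
    by (intro summable_on_cmult_right rogers_szego_summable)
  have f3: "(\<lambda>n. - (?s (k - n) * (?s (n - 1) * w powi (2 * n - (k + 1))))) summable_on UNIV"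
    by (intro summable_on_uminus[THEN iffD2] rogers_szego_summable)
  have "(1 - q powi (- (k + 1))) * (?s (k + 1 - n) * (?s n * w powi (2 * n - (k + 1)))) =
      (?s (k + 1 - n) * (?s (n - 1) * w powi (2 * n - (k + 1)))
       + 1 / w * (?s (k - n) * (?s (n - 0) * w powi (2 * n - k))))
      + - (?s (k - n) * (?s (n - 1) * w powi (2 * n - (k + 1))))" for n
  proof -
    have w: "w powi (2 * n - (k + 1)) = 1 / w * w powi (2 * n - k)"
      using assms power_int_diff[of w "2 * n - k" 1] by (simp add: algebra_simps)
    have Q: "q powi (- (k + 1)) = q powi (- n) * q powi (- (k + 1 - n))"
      using q_nonzero power_int_add[of q "- n" "- (k + 1 - n)"] by simp
    have 1: "?s (n - 1) = (1 - q powi (- n)) * ?s n" by (rule recip_qfact_inv_rec[symmetric])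
    have 2: "?s (k - n) = (1 - q powi (- (k + 1 - n))) * ?s (k + 1 - n)"
      using recip_qfact_inv_rec[of "k + 1 - n"] unfolding s by (rule sym)
    show ?thesis unfolding w 1 2 Q by (simp add: algebra_simps add_divide_distrib diff_divide_distrib)
  qed
  then have "(1 - q powi (- (k + 1))) * rogers_szego (k + 1) w =
      (\<Sum>\<^sub>\<infinity>n. (?s (k + 1 - n) * (?s (n - 1) * w powi (2 * n - (k + 1)))
       + 1 / w * (?s (k - n) * (?s (n - 0) * w powi (2 * n - k))))
      + - (?s (k - n) * (?s (n - 1) * w powi (2 * n - (k + 1)))))"
    unfolding rogers_szego_def infsum_cmult_right'[symmetric] by simp
  also have "\<dots> = ((\<Sum>\<^sub>\<infinity>n. ?s (k + 1 - n) * (?s (n - 1) * w powi (2 * n - (k + 1))))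
      + (\<Sum>\<^sub>\<infinity>n. 1 / w * (?s (k - n) * (?s (n - 0) * w powi (2 * n - k)))))
      + (\<Sum>\<^sub>\<infinity>n. - (?s (k - n) * (?s (n - 1) * w powi (2 * n - (k + 1)))))"
    by (simp only: infsum_add[OF summable_on_add[OF f1 f2] f3] infsum_add[OF f1 f2])
  also have "(\<Sum>\<^sub>\<infinity>n. ?s (k + 1 - n) * (?s (n - 1) * w powi (2 * n - (k + 1)))) = w * rogers_szego k w"
    unfolding rogers_szego_def infsum_cmult_right'[symmetric]
  proof (rule infsum_reindex_bij_witness[where j = "\<lambda>n. n - 1" and i = "\<lambda>n. n + 1"])
    fix n :: int
    have "w * w powi (2 * (n - 1) - k) = w powi (2 * n - (k + 1))"
      using assms power_int_add[of w 1 "2 * (n - 1) - k"] by (simp add: algebra_simps)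
    moreover have "k - (n - 1) = k + 1 - n" by simp
    ultimately show "w * (?s (k - (n - 1)) * (?s (n - 1) * w powi (2 * (n - 1) - k)))
        = ?s (k + 1 - n) * (?s (n - 1) * w powi (2 * n - (k + 1)))"
      by (metis mult.left_commute)
  qed auto
  also have "(\<Sum>\<^sub>\<infinity>n. - (?s (k - n) * (?s (n - 1) * w powi (2 * n - (k + 1))))) = - rogers_szego (k - 1) w"
    unfolding infsum_uminus rogers_szego_def
    by (rule arg_cong[where f = uminus],
        rule infsum_reindex_bij_witness[where j = "\<lambda>n. n - 1" and i = "\<lambda>n. n + 1"])
      (auto simp: algebra_simps)
  also have "(\<Sum>\<^sub>\<infinity>n. 1 / w * (?s (k - n) * (?s (n - 0) * w powi (2 * n - k)))) = 1 / w * rogers_szego k w"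
    unfolding infsum_cmult_right' rogers_szego_def by simp
  finally show ?thesis by (simp add: algebra_simps)
qed

lemma q_poch_eq_recip_qfact: "q_poch q q (int n) = 1 / recip_qfact (int n)"
  by (simp add: q_poch_def recip_qfact_def)

lemma q_poch_neg_power:
  assumes "n \<le> k"
  shows "q_poch q (q powi (- int k)) (int n) * recip_qfact_inv (int k) = recip_qfact_inv (int k - int n)"
  using assms
proof (induction n)
  case 0 then show ?case by (simp add: q_poch_def)
next
  case (Suc n)
  have "q powi (- int k) * q ^ n = q powi (- (int k - int n))"
    using q_nonzero power_int_add[of q "- int k" "int n"] by simp
  then have "q_poch q (q powi (- int k)) (int (Suc n))
      = q_poch q (q powi (- int k)) (int n) * (1 - q powi (- (int k - int n)))"
    by (simp add: q_poch_def nat_add_distrib)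
  then have "q_poch q (q powi (- int k)) (int (Suc n)) * recip_qfact_inv (int k)
      = (1 - q powi (- (int k - int n))) * recip_qfact_inv (int k - int n)"
    using Suc by simp
  also have "\<dots> = recip_qfact_inv (int k - int (Suc n))"
    unfolding recip_qfact_inv_rec by (simp add: algebra_simps)
  finally show ?case .
qed

lemma q_poch_neg_power_vanishes:
  assumes "k < n"
  shows "q_poch q (q powi (- int k)) (int n) = 0"
proof -
  have "1 - q powi (- int k) * q ^ k = 0"
    using q_nonzero by (simp add: power_int_minus)
  then show ?thesis using assms by (auto simp: q_poch_def)
qed

lemma theta_coeff_nat:
  "theta_coeff (int n) = (-1) ^ n * q ^ (n * (n - 1) div 2) * q ^ n"
proof -
  have "int n * (int n + 1) div 2 = int (n * (n - 1) div 2 + n)"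
  proof -
    have "int n * (int n + 1) = int (n * (n - 1)) + 2 * int n"
      by (cases n) (auto simp: algebra_simps)
    then show ?thesis by (simp add: zdiv_int)
  qed
  then show ?thesis by (simp add: theta_coeff_def power_add del: of_nat_add)
qed

text \<open>For \<open>k \<ge> 0\<close> the series terminates, since \<open>(q\<^bsup>-k\<^esup>)\<^sub>n = 0\<close> for \<open>n > k\<close>, and
  \<open>(q\<^bsup>-k\<^esup>)\<^sub>n / (q\<^bsup>-k\<^esup>)\<^sub>k = 1 / (p; p)\<^bsub>k-n\<^esub>\<close> for \<open>n \<le> k\<close>, with \<open>p = 1 / q\<close>. For negative \<open>k\<close> the left side
  contains \<open>(1)\<^sub>\<infinity> = 0\<close>, and the sum on the right is empty.\<close>

lemma phi11_0_eq_rogers_szego: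
  assumes "w \<noteq> 0"
  shows "w powi (- k) * q_poch_recip q (q powi (- k)) k * phi11_0 q (q powi (- k)) (w\<^sup>2 * q) = rogers_szego k w"
proof (cases "0 \<le> k")
  case False
  then have "q powi k * q powi (- k) = 1" using q_nonzero by (simp add: power_int_minus)
  with False show ?thesis by (simp add: q_poch_recip_def rogers_szego_neg)
next
  case True
  then obtain K where k: "k = int K" by (metis zero_le_imp_eq_int)
  have "q_poch q (q powi (- k)) k * recip_qfact_inv k = 1"
    using q_poch_neg_power[of K K] by (simp add: k recip_qfact_inv_def[of 0])
  then have recip: "q_poch_recip q (q powi (- k)) k = recip_qfact_inv k"
    using True by (auto simp: q_poch_recip_def divide_eq_eq mult.commute)
  have "phi11_0 q (q powi (- k)) (w\<^sup>2 * q) =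
      (\<Sum>n\<le>K. q_poch q (q powi (- k)) (int n) / q_poch q q (int n)
            * (-1) ^ n * q ^ (n * (n - 1) div 2) * (w\<^sup>2 * q) ^ n)"
    unfolding phi11_0_def k
    by (rule suminf_finite) (auto simp: q_poch_neg_power_vanishes)
  then have "w powi (- k) * q_poch_recip q (q powi (- k)) k * phi11_0 q (q powi (- k)) (w\<^sup>2 * q) =
      (\<Sum>n\<le>K. w powi (- k) * recip_qfact_inv k * (q_poch q (q powi (- k)) (int n) / q_poch q q (int n)
            * (-1) ^ n * q ^ (n * (n - 1) div 2) * (w\<^sup>2 * q) ^ n))"
    unfolding recip by (simp only: sum_distrib_left)
  also have "\<dots> = (\<Sum>n\<le>K. recip_qfact_inv (k - int n) * (recip_qfact_inv (int n) * w powi (2 * int n - k)))"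
  proof (rule sum.cong)
    fix n assume "n \<in> {..K}"
    then have P: "q_poch q (q powi (- k)) (int n) * recip_qfact_inv k = recip_qfact_inv (k - int n)"
      unfolding k by (intro q_poch_neg_power) simp
    have W: "w powi (2 * int n - k) = w powi (- k) * (w\<^sup>2) ^ n"
      using assms power_int_add[of w "- k" "2 * int n"]
      by (simp add: power_int_mult power_int_numeral)
    show "w powi (- k) * recip_qfact_inv k * (q_poch q (q powi (- k)) (int n) / q_poch q q (int n)
            * (-1) ^ n * q ^ (n * (n - 1) div 2) * (w\<^sup>2 * q) ^ n)
        = recip_qfact_inv (k - int n) * (recip_qfact_inv (int n) * w powi (2 * int n - k))"
      unfolding P[symmetric] W recip_qfact_inv_def[of "int n"] theta_coeff_nat q_poch_eq_recip_qfact
      by (simp add: power_mult_distrib)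
  qed auto
  also have "\<dots> = rogers_szego k w"
    unfolding rogers_szego_as_sum k
    by (rule sum.reindex_bij_witness[where j = int and i = nat]) auto
  finally show ?thesis .
qed

end

section \<open>From the elliptic variables to the multiplicative ones\<close>

text \<open>All exponentials that occur, including \<open>q\<^bsup>k/2\<^esup>\<close> and \<open>q\<^bsup>1/8\<^esup>\<close>, are values of this function. Identities
  between them then reduce to linear identities between their arguments.\<close>

definition ee :: "complex \<Rightarrow> complex" where
  "ee x = exp (of_real pi * \<i> * x)"

lemma ee_0 [simp]: "ee 0 = 1" by (simp add: ee_def)

lemma ee_nonzero [simp]: "ee x \<noteq> 0" by (simp add: ee_def)

lemma ee_add: "ee (x + y) = ee x * ee y"
  by (simp add: ee_def exp_add distrib_left)

lemma ee_diff: "ee (x - y) = ee x / ee y"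
  by (simp add: ee_def exp_diff right_diff_distrib)

lemma ee_minus: "ee (- x) = 1 / ee x"
  using ee_diff[of 0 x] by simp

lemma ee_powi: "ee x powi n = ee (of_int n * x)"
  by (simp add: ee_def exp_power_int mult_ac)

lemma ee_1 [simp]: "ee 1 = -1" by (simp add: ee_def)

lemma ee_2 [simp]: "ee 2 = 1"
  using ee_add[of 1 1] by simp

lemma ee_of_int: "ee (of_int n) = (-1) powi n"
  using ee_powi[of 1 n] by simp

lemma ee_half: "ee (1 / 2) = \<i>"
  by (simp add: ee_def complex_eq_iff Re_exp Im_exp)

lemma ee_double: "ee (2 * x) = (ee x)\<^sup>2"
  using ee_add[of x x] by (simp add: power2_eq_square)

lemma exp_eq_ee:
  "exp (2 * of_real pi * \<i> * x) = ee (2 * x)"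
  "exp (of_real pi * \<i> * x) = ee x"
  "exp (of_real pi * \<i> * y * x) = ee (y * x)"
  "exp (- of_real pi * \<i> * x) = ee (- x)"
  "exp (- of_real pi * \<i> * y * x) = ee (- (y * x))"
  by (simp_all add: ee_def mult_ac)

lemma q_pow_eq_ee: "q_pow \<tau> s = ee (2 * s * \<tau>)"
  by (simp add: q_pow_def ee_def mult_ac)

lemma sin_eq_ee: "2 * \<i> * sin (of_real pi * x) = ee x - ee (- x)"
  by (simp add: sin_exp_eq ee_def mult_ac)

lemma cos_eq_ee: "2 * cos (of_real pi * x) = ee x + ee (- x)"
  by (simp add: cos_exp_eq ee_def mult_ac)

locale upper_half_plane =
  fixes \<tau> :: complex
  assumes Im_tau: "Im \<tau> > 0"

sublocale upper_half_plane \<subseteq> punctured_unit_disc "ee (2 * \<tau>)"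
proof
  show "ee (2 * \<tau>) \<noteq> 0" by simp
  show "norm (ee (2 * \<tau>)) < 1" using Im_tau by (simp add: ee_def)
qed

context upper_half_plane
begin

abbreviation q :: complex where "q \<equiv> ee (2 * \<tau>)"

lemma q_powi: "q powi n = ee (2 * of_int n * \<tau>)"
  by (simp add: ee_powi mult_ac)

text \<open>The hypothesis on the period lattice in multiplicative form.\<close>

lemma off_spiral_ee:
  assumes "u \<notin> period_lattice \<tau>"
  shows "off_spiral (ee (2 * u))"
  unfolding off_spiral_def
proof (intro conjI allI notI)
  fix m :: int
  assume "ee (2 * u) * q powi m = 1"
  then have "ee (2 * (u + of_int m * \<tau>)) = 1"
    by (simp add: q_powi distrib_left mult.assoc flip: ee_add)
  then obtain n :: int where
    "2 * Re u + 2 * (of_int m * Re \<tau>) = 2 * of_int n" "2 * Im u + 2 * (of_int m * Im \<tau>) = 0"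
    by (auto simp: ee_def exp_eq_1)
  then have "u = of_int n + of_int (- m) * \<tau>" by (simp add: complex_eq_iff)
  then show False using assms unfolding period_lattice_def by blast
qed simp

lemma theta_coeff_ee: "theta_coeff n = ee (of_int n + of_int n * (of_int n + 1) * \<tau>)"
proof -
  have "2 * (n * (n + 1) div 2) = n * (n + 1)" by simp
  then have "2 * complex_of_int (n * (n + 1) div 2) = of_int n * (of_int n + 1)"
    by (metis of_int_add of_int_mult of_int_numeral of_int_1)
  then show ?thesis
    unfolding theta_coeff_def q_powi by (simp add: ee_add ee_of_int)
qed

definition theta_const :: complex where
  "theta_const = \<i> * q_pow \<tau> (1/8)"

lemma theta_const_ee: "theta_const = ee (1/2 + \<tau>/4)"
  by (simp add: theta_const_def q_pow_eq_ee ee_add ee_half)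

lemma theta_const_nonzero [simp]: "theta_const \<noteq> 0"
  by (simp add: theta_const_ee)

text \<open>In \<open>(n + 1/2)\<^sup>2 = n (n + 1) + 1/4\<close> and \<open>(n + 1/2) u = n u + u / 2\<close> the contributions of the half-integers do
  not depend on \<open>n\<close> and factor out.\<close>

lemma theta11_eq: "theta11 \<tau> u = theta_const * ee u * theta_sum (ee (2 * u))"
proof -
  have "exp (2 * of_real pi * \<i> * (of_int n + 1/2) * (u + 1/2) + of_real pi * \<i> * (of_int n + 1/2)\<^sup>2 * \<tau>)
      = theta_const * ee u * (theta_coeff n * ee (2 * u) powi n)" for n :: int
  proof -
    have "2 * of_real pi * \<i> * (of_int n + 1/2) * (u + 1/2) + of_real pi * \<i> * (of_int n + 1/2)\<^sup>2 * \<tau>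
        = of_real pi * \<i> * ((1/2 + \<tau>/4) + u + ((of_int n + of_int n * (of_int n + 1) * \<tau>) + of_int n * (2 * u)))"
      by (simp add: field_simps power2_eq_square)
    then have "exp (2 * of_real pi * \<i> * (of_int n + 1/2) * (u + 1/2) + of_real pi * \<i> * (of_int n + 1/2)\<^sup>2 * \<tau>)
        = ee ((1/2 + \<tau>/4) + u + ((of_int n + of_int n * (of_int n + 1) * \<tau>) + of_int n * (2 * u)))"
      by (simp only: ee_def)
    then show ?thesis
      by (simp only: theta_const_ee theta_coeff_ee ee_powi ee_add)
  qed
  then show ?thesis
    unfolding theta11_def theta_sum_def infsum_cmult_right'[symmetric] by simp
qed

lemma theta11_0: "theta11 \<tau> 0 = 0"
  by (simp add: theta11_eq)

lemma theta11_tau: "theta11 \<tau> \<tau> = 0"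
  using theta_sum_shift[of 1] by (simp add: theta11_eq)

lemma series_weight:
  "(-1) powi n * exp (2 * of_real pi * \<i> * (of_int n + 1/2) * v) * q_pow \<tau> (of_int n * (of_int n + 1) / 2)
    = ee v * (theta_coeff n * ee (2 * v) powi n)"
proof -
  have "exp (2 * of_real pi * \<i> * (of_int n + 1/2) * v) = ee v * ee (2 * v) powi n"
    unfolding ee_powi ee_add[symmetric] unfolding ee_def
    by (rule arg_cong[of _ _ exp]) (simp add: field_simps)
  then show ?thesis
    by (simp add: theta_coeff_ee ee_add ee_of_int q_pow_eq_ee)
qed

lemma gen_mu_summand_factor:
  "q_poch_inf (q_pow \<tau> 1) (exp (2 * of_real pi * \<i> * u) * q_pow \<tau> (of_int n + 1))
     / q_poch_inf (q_pow \<tau> 1) (exp (2 * of_real pi * \<i> * u) * q_pow \<tau> (of_int n - of_int k + 1))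
   = mu_factor k (ee (2 * u) * q powi n)"
proof -
  have 1: "q_pow \<tau> 1 = q" by (simp add: q_pow_eq_ee)
  have 2: "exp (2 * of_real pi * \<i> * u) * q_pow \<tau> (of_int n + 1) = ee (2 * u) * q powi n * q"
    unfolding q_pow_eq_ee exp_eq_ee q_powi
    unfolding mult.assoc ee_add[symmetric] by (simp add: algebra_simps)
  have 3: "exp (2 * of_real pi * \<i> * u) * q_pow \<tau> (of_int n - of_int k + 1) = ee (2 * u) * q powi n * q powi (1 - k)"
    unfolding q_pow_eq_ee exp_eq_ee q_powi
    unfolding mult.assoc ee_add[symmetric] by (simp add: algebra_simps)
  show ?thesis unfolding 1 2 3 mu_factor_def ..
qed

lemma gen_mu_eq:
  "gen_mu \<tau> u v (of_int k) =
    ee (u - v) powi k * appell_lerch k (ee (2 * u)) (ee (2 * v)) / (theta_const * theta_sum (ee (2 * v)))"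
proof -
  have "gen_mu \<tau> u v (of_int k) = ee (of_int k * (u - v)) / theta11 \<tau> v *
      (ee v * appell_lerch k (ee (2 * u)) (ee (2 * v)))"
    unfolding gen_mu_def series_weight gen_mu_summand_factor exp_eq_ee(3) appell_lerch_eq
      infsum_cmult_right'[symmetric] by (simp only: mult.assoc)
  then show ?thesis by (simp add: theta11_eq ee_powi)
qed

lemma zwegers_mu_eq_gen_mu:
  assumes "u \<notin> period_lattice \<tau>"
  shows "zwegers_mu \<tau> u v = gen_mu \<tau> u v (of_int 1)"
proof -
  have "(-1) powi n * exp (2 * of_real pi * \<i> * of_int n * v) * q_pow \<tau> (of_int n * (of_int n + 1) / 2)
        / (1 - exp (2 * of_real pi * \<i> * u) * q_pow \<tau> (of_int n))
      = theta_coeff n * (ee (2 * v) powi n * (1 / (1 - ee (2 * u) * q powi n)))" for n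
  proof -
    have "exp (2 * of_real pi * \<i> * of_int n * v) = ee (2 * v) powi n"
      by (simp add: ee_def exp_power_int mult_ac)
    moreover have "q_pow \<tau> (of_int n) = q powi n" by (simp add: q_pow_eq_ee q_powi)
    ultimately show ?thesis
      unfolding exp_eq_ee by (simp add: theta_coeff_ee ee_add ee_of_int q_pow_eq_ee)
  qed
  then have "zwegers_mu \<tau> u v = ee u / theta11 \<tau> v * appell_lerch 1 (ee (2 * u)) (ee (2 * v))"
    unfolding zwegers_mu_def appell_lerch_1[OF off_spiral_ee[OF assms]] exp_eq_ee by simp
  then show ?thesis unfolding gen_mu_eq by (simp add: theta11_eq ee_diff field_simps)
qed

lemma ee_double_diff: "ee (2 * u) / ee (2 * v) = (ee (u - v))\<^sup>2"
  by (simp add: ee_double ee_diff power_divide)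

text \<open>At \<open>k = 0\<close> the rational factor is \<open>1\<close>, so the series is the theta series that it is divided by.\<close>

lemma gen_mu_0:
  assumes "u \<notin> period_lattice \<tau>" "v \<notin> period_lattice \<tau>"
  shows "gen_mu \<tau> u v (of_int 0) = 1 / theta_const"
  unfolding gen_mu_eq using assms
  by (simp add: appell_lerch_0 off_spiral_ee theta_sum_off_spiral)

lemma gen_mu_three_term:
  assumes "u \<notin> period_lattice \<tau>"
  shows "2 * cos (of_real pi * (u - v)) * gen_mu \<tau> u v (of_int k) =
    (1 - q_pow \<tau> (- of_int k)) * gen_mu \<tau> u v (of_int (k + 1)) + gen_mu \<tau> u v (of_int (k - 1))"
proof -
  define w where "w = ee (u - v)"
  define K where "K = theta_const * theta_sum (ee (2 * v))"
  let ?S = "\<lambda>k. appell_lerch k (ee (2 * u)) (ee (2 * v))"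
  have w: "w \<noteq> 0" by (simp add: w_def)
  have W: "w powi (k - 1) = w powi k / w" "w powi (k + 1) = w powi k * w"
    using w by (simp_all add: power_int_diff power_int_add)
  have Q: "q_pow \<tau> (- of_int k) = q powi (- k)" by (simp add: q_pow_eq_ee q_powi)
  have c: "2 * cos (of_real pi * (u - v)) = w + 1 / w"
    unfolding cos_eq_ee ee_minus w_def ..
  have S: "(1 + w\<^sup>2) * ?S k = ?S (k - 1) + w\<^sup>2 * (1 - q powi (- k)) * ?S (k + 1)"
    using appell_lerch_three_term[OF off_spiral_ee[OF assms], of "ee (2 * v)" k]
    unfolding ee_double_diff w_def[symmetric] by simp
  have "(w + 1 / w) * (w powi k * ?S k / K) = w powi k / w / K * ((1 + w\<^sup>2) * ?S k)"
    using w by (simp add: field_simps power2_eq_square)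
  also have "\<dots> = (1 - q powi (- k)) * (w powi (k + 1) * ?S (k + 1) / K) + w powi (k - 1) * ?S (k - 1) / K"
    unfolding S W using w by (simp add: algebra_simps add_divide_distrib diff_divide_distrib power2_eq_square)
  finally show ?thesis unfolding c Q gen_mu_eq w_def[symmetric] K_def[symmetric] .
qed

text \<open>The multiplicative translation formula, divided by the two theta series at \<open>y\<close> and \<open>y z\<close>. Writing all theta
  series in terms of \<open>theta11\<close> turns the factor \<open>w / x\<close> into a product of the normalizing exponentials.\<close>

lemma zwegers_translation:
  assumes "u \<notin> period_lattice \<tau>" "v \<notin> period_lattice \<tau>"
    and "u + z \<notin> period_lattice \<tau>" "v + z \<notin> period_lattice \<tau>"
  shows "gen_mu \<tau> (u + z) (v + z) (of_int 1) = gen_mu \<tau> u v (of_int 1)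
    + \<i> * q_pow \<tau> (1/8) * q_poch_inf q q ^ 3 * theta11 \<tau> z * theta11 \<tau> (u + v + z)
      / (theta11 \<tau> u * theta11 \<tau> v * theta11 \<tau> (u + z) * theta11 \<tau> (v + z))"
proof -
  define x y Z where "x = ee (2 * u)" and "y = ee (2 * v)" and "Z = ee (2 * z)"
  have E: "ee (2 * (u + z)) = x * Z" "ee (2 * (v + z)) = y * Z" "ee (2 * (u + v + z)) = x * y * Z"
    by (simp_all add: x_def y_def Z_def distrib_left ee_add)
  have off: "off_spiral x" "off_spiral y" "off_spiral (x * Z)" "off_spiral (y * Z)"
    using assms[THEN off_spiral_ee] unfolding E by (simp_all add: x_def y_def)
  note nz = off[THEN theta_sum_off_spiral]
  have T: "theta_sum y * appell_lerch 1 (x * Z) (y * Z) - theta_sum (y * Z) * appell_lerch 1 x y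
    = q_poch_inf q q ^ 3 * theta_sum Z * theta_sum (x * y * Z) / (x * theta_sum x * theta_sum (x * Z))"
    by (rule appell_lerch_translation[OF off(1,3)]) (simp_all add: y_def Z_def)
  have T': "appell_lerch 1 (x * Z) (y * Z) / theta_sum (y * Z) = appell_lerch 1 x y / theta_sum y
     + q_poch_inf q q ^ 3 * theta_sum Z * theta_sum (x * y * Z)
       / (x * theta_sum x * theta_sum y * theta_sum (x * Z) * theta_sum (y * Z))"
  proof -
    have "appell_lerch 1 (x * Z) (y * Z) / theta_sum (y * Z) = appell_lerch 1 x y / theta_sum y
      + (theta_sum y * appell_lerch 1 (x * Z) (y * Z) - theta_sum (y * Z) * appell_lerch 1 x y)
        / (theta_sum y * theta_sum (y * Z))"
      using nz by (simp add: field_simps)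
    then show ?thesis unfolding T by (simp add: mult_ac)
  qed
  have x2: "x = ee u * ee u" by (simp add: x_def ee_double power2_eq_square)
  have "gen_mu \<tau> (u + z) (v + z) (of_int 1)
      = ee (u - v) / theta_const * (appell_lerch 1 (x * Z) (y * Z) / theta_sum (y * Z))"
    unfolding gen_mu_eq E by simp
  also have "\<dots> = gen_mu \<tau> u v (of_int 1) + ee (u - v) / theta_const *
     (q_poch_inf q q ^ 3 * theta_sum Z * theta_sum (x * y * Z)
       / (x * theta_sum x * theta_sum y * theta_sum (x * Z) * theta_sum (y * Z)))"
    unfolding T' gen_mu_eq x_def[symmetric] y_def[symmetric] by (simp add: algebra_simps)
  also have "ee (u - v) / theta_const *
     (q_poch_inf q q ^ 3 * theta_sum Z * theta_sum (x * y * Z)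
       / (x * theta_sum x * theta_sum y * theta_sum (x * Z) * theta_sum (y * Z)))
    = theta_const * q_poch_inf q q ^ 3 * theta11 \<tau> z * theta11 \<tau> (u + v + z)
      / (theta11 \<tau> u * theta11 \<tau> v * theta11 \<tau> (u + z) * theta11 \<tau> (v + z))"
    unfolding theta11_eq E x_def[symmetric] y_def[symmetric] Z_def[symmetric] ee_add ee_diff
    unfolding x2[THEN arg_cong[of _ _ "\<lambda>c. c * theta_sum x"]]
    using nz by (simp add: divide_simps)
  finally show ?thesis unfolding theta_const_def .
qed

end

section \<open>The generalized mu-function at integral index\<close>

lemma period_lattice_uminus: "u \<notin> period_lattice \<tau> \<Longrightarrow> - u \<notin> period_lattice \<tau>"
proof
  assume "- u \<in> period_lattice \<tau>"
  then obtain m n where "- u = of_int m + of_int n * \<tau>" unfolding period_lattice_def by blast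
  then have "u = of_int (- m) + of_int (- n) * \<tau>"
    by (simp add: minus_equation_iff[of u] eq_commute)
  then have "u \<in> period_lattice \<tau>" unfolding period_lattice_def by blast
  moreover assume "u \<notin> period_lattice \<tau>"
  ultimately show False by blast
qed

lemma period_lattice_add_tau:
  "u \<notin> period_lattice \<tau> \<Longrightarrow> u + of_int j * \<tau> \<notin> period_lattice \<tau>"
proof
  assume "u + of_int j * \<tau> \<in> period_lattice \<tau>"
  then obtain m n where "u + of_int j * \<tau> = of_int m + of_int n * \<tau>"
    unfolding period_lattice_def by blast
  then have "u = of_int m + of_int (n - j) * \<tau>" by (simp add: algebra_simps)
  then have "u \<in> period_lattice \<tau>" unfolding period_lattice_def by blast
  moreover assume "u \<notin> period_lattice \<tau>"
  ultimately show False by blast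
qed

context upper_half_plane
begin

text \<open>The multiplicative variables have period \<open>1\<close> in \<open>u\<close> and \<open>v\<close>; only the prefactor \<open>w\<^sup>k\<close> sees the shift,
  which changes the sign of \<open>w\<close>.\<close>

lemma gen_mu_plus_1_left: "gen_mu \<tau> (u + 1) v (of_int k) = (-1) powi k * gen_mu \<tau> u v (of_int k)"
proof -
  have "ee (u + 1 - v) = - 1 * ee (u - v)" "ee (2 * (u + 1)) = ee (2 * u)"
    by (simp_all add: ee_add ee_diff distrib_left)
  then show ?thesis unfolding gen_mu_eq by (simp only: power_int_mult_distrib) simp
qed

lemma gen_mu_plus_1_right: "gen_mu \<tau> u (v + 1) (of_int k) = (-1) powi k * gen_mu \<tau> u v (of_int k)"
proof -
  have "ee (u - (v + 1)) = - 1 * ee (u - v)" "ee (2 * (v + 1)) = ee (2 * v)"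
    by (simp_all add: ee_add ee_diff distrib_left)
  then show ?thesis unfolding gen_mu_eq by (simp only: power_int_mult_distrib) simp
qed

lemma q_pow_half: "q_pow \<tau> (of_int k / 2) = ee \<tau> powi k"
  by (simp add: q_pow_eq_ee ee_powi)

lemma gen_mu_plus_tau:
  assumes "u \<notin> period_lattice \<tau>"
  shows "gen_mu \<tau> (u + \<tau>) v (of_int k) =
       - exp (2 * of_real pi * \<i> * (u - v)) * q_pow \<tau> (of_int k / 2) * gen_mu \<tau> u v (of_int k)
       + exp (of_real pi * \<i> * (u - v)) * q_pow \<tau> (of_int k / 2) * gen_mu \<tau> u v (of_int (k - 1))"
proof -
  define w where "w = ee (u - v)"
  let ?S = "\<lambda>k. appell_lerch k (ee (2 * u)) (ee (2 * v))"
  define p where "p = w powi (k - 1)"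
  define h where "h = ee \<tau> powi k"
  define K where "K = theta_const * theta_sum (ee (2 * v))"
  have w: "w powi k = w * p" by (simp add: p_def w_def power_int_diff)
  have 1: "ee (u + \<tau> - v) = w * ee \<tau>" "ee (2 * (u + \<tau>)) = ee (2 * u) * q"
    by (simp_all add: w_def ee_add ee_diff distrib_left)
  have 2: "appell_lerch k (ee (2 * u) * q) (ee (2 * v)) = ?S (k - 1) - w\<^sup>2 * ?S k"
    using appell_lerch_q_mult[OF off_spiral_ee[OF assms], of "ee (2 * v)" k]
    unfolding ee_double_diff w_def[symmetric] by simp
  have 3: "exp (2 * of_real pi * \<i> * (u - v)) = w\<^sup>2" "exp (of_real pi * \<i> * (u - v)) = w"
    unfolding exp_eq_ee ee_double w_def by (rule refl)+
  show ?thesis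
    unfolding 3 q_pow_half gen_mu_eq 1 2 w_def[symmetric] power_int_mult_distrib w p_def[symmetric]
      h_def[symmetric] K_def[symmetric]
    by (simp add: divide_inverse power2_eq_square algebra_simps)
qed

lemma gen_mu_minus_tau:
  assumes "u \<notin> period_lattice \<tau>"
  shows "gen_mu \<tau> (u - \<tau>) v (of_int k) =
       q_pow \<tau> (of_int k / 2) * gen_mu \<tau> u v (of_int k)
       - 2 * \<i> * exp (- of_real pi * \<i> * (u - v)) * sin (of_real pi * of_int k * \<tau>)
         * gen_mu \<tau> u v (of_int (k + 1))"
proof -
  define w where "w = ee (u - v)"
  define h where "h = ee \<tau> powi k"
  define K where "K = theta_const * theta_sum (ee (2 * v))"
  let ?S = "\<lambda>k. appell_lerch k (ee (2 * u)) (ee (2 * v))"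
  have nz: "w \<noteq> 0" "h \<noteq> 0" by (simp_all add: w_def h_def)
  have w: "w powi (k + 1) = w powi k * w" using nz by (simp add: power_int_add)
  have 1: "ee (u - \<tau> - v) powi k = w powi k / h" "ee (2 * (u - \<tau>)) = ee (2 * u) / q"
  proof -
    have "ee (u - \<tau> - v) = w / ee \<tau>" by (simp add: w_def ee_diff)
    then show "ee (u - \<tau> - v) powi k = w powi k / h" by (simp only: h_def power_int_divide_distrib)
    show "ee (2 * (u - \<tau>)) = ee (2 * u) / q" by (simp add: ee_diff right_diff_distrib)
  qed
  have "q powi k = h\<^sup>2" by (simp add: h_def ee_double power2_eq_square power_int_mult_distrib)
  then have 2: "appell_lerch k (ee (2 * u) / q) (ee (2 * v)) = h\<^sup>2 * ?S k + (1 - h\<^sup>2) * ?S (k + 1)"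
    using appell_lerch_q_div[OF off_spiral_ee[OF assms], of k "ee (2 * v)"] by simp
  have algebra: "p / h * (h\<^sup>2 * s + (1 - h\<^sup>2) * t) / K
      = h * (p * s / K) - (h - 1 / h) * (1 / w) * (p * w * t / K)" for p s t
    by (cases "K = 0") (use nz in \<open>simp_all add: field_simps power2_eq_square\<close>)
  have 3: "exp (- of_real pi * \<i> * (u - v)) = 1 / w"
    unfolding exp_eq_ee ee_minus w_def ..
  have "2 * \<i> * sin (of_real pi * of_int k * \<tau>) = h - 1 / h"
    using sin_eq_ee[of "of_int k * \<tau>"] unfolding ee_minus h_def ee_powi mult.assoc .
  then have 4: "2 * \<i> * c * sin (of_real pi * of_int k * \<tau>) = (h - 1 / h) * c" for c
    by (metis mult.assoc mult.commute)
  show ?thesis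
    unfolding 4 3 q_pow_half h_def[symmetric] gen_mu_eq 1 2 w_def[symmetric] w K_def[symmetric]
    by (rule algebra)
qed

text \<open>The three-term recurrence involves \<open>u\<close> and \<open>v\<close> only through the cosine, and the value at \<open>k = 0\<close> is the same
  constant for all arguments off the lattice, so a symmetry has to be checked at \<open>k = 1\<close> only.\<close>

lemma gen_mu_eqI:
  assumes "u \<notin> period_lattice \<tau>" "v \<notin> period_lattice \<tau>"
    and "u' \<notin> period_lattice \<tau>" "v' \<notin> period_lattice \<tau>"
    and "cos (of_real pi * (u - v)) = cos (of_real pi * (u' - v'))"
    and "gen_mu \<tau> u v (of_int 1) = gen_mu \<tau> u' v' (of_int 1)"
  shows "gen_mu \<tau> u v (of_int k) = gen_mu \<tau> u' v' (of_int k)"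
proof (rule three_term_recurrence_unique[where A = "\<lambda>k. gen_mu \<tau> u v (of_int k)"])
  show "2 * cos (of_real pi * (u - v)) * gen_mu \<tau> u v (of_int k) =
    (1 - q_pow \<tau> (- of_int k)) * gen_mu \<tau> u v (of_int (k + 1)) + gen_mu \<tau> u v (of_int (k - 1))" for k
    by (rule gen_mu_three_term[OF assms(1)])
  show "2 * cos (of_real pi * (u - v)) * gen_mu \<tau> u' v' (of_int k) =
    (1 - q_pow \<tau> (- of_int k)) * gen_mu \<tau> u' v' (of_int (k + 1)) + gen_mu \<tau> u' v' (of_int (k - 1))" for k
    unfolding assms(5) by (rule gen_mu_three_term[OF assms(3)])
  show "1 - q_pow \<tau> (- of_int k) \<noteq> 0" if "0 < k" for k
    using one_minus_q_powi_nonzero[of "- k"] that unfolding q_powi q_pow_eq_ee by simp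
  show "gen_mu \<tau> u v (of_int 0) = gen_mu \<tau> u' v' (of_int 0)"
    unfolding gen_mu_0[OF assms(1,2)] gen_mu_0[OF assms(3,4)] ..
qed (rule assms(6))

text \<open>For \<open>z = \<tau>\<close> the correction in the translation formula contains \<open>theta11 \<tau> \<tau> = 0\<close>.\<close>

lemma gen_mu_plus_tau_both:
  assumes "u \<notin> period_lattice \<tau>" "v \<notin> period_lattice \<tau>"
  shows "gen_mu \<tau> (u + \<tau>) (v + \<tau>) (of_int k) = gen_mu \<tau> u v (of_int k)"
proof -
  have *: "u + \<tau> \<notin> period_lattice \<tau>" "v + \<tau> \<notin> period_lattice \<tau>"
    using assms[THEN period_lattice_add_tau[where j = 1]] by simp_all
  show ?thesis
    by (rule gen_mu_eqI[OF * assms])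
      (use zwegers_translation[OF assms *] in \<open>simp_all add: theta11_tau\<close>)
qed

lemma gen_mu_uminus:
  assumes "u \<notin> period_lattice \<tau>" "v \<notin> period_lattice \<tau>"
  shows "gen_mu \<tau> (- u) (- v) (of_int k) = gen_mu \<tau> u v (of_int k)"
proof (rule gen_mu_eqI)
  have "cos (of_real pi * (- u - - v)) = cos (- (of_real pi * (u - v)))" by (simp add: algebra_simps)
  then show "cos (of_real pi * (- u - - v)) = cos (of_real pi * (u - v))" by (simp only: cos_minus)
  let ?x = "ee (2 * u)" and ?y = "ee (2 * v)"
  have 1: "ee (2 * (- u)) = 1 / ?x" "ee (2 * (- v)) = 1 / ?y" by (simp_all add: ee_minus)
  have 2: "ee (- u - - v) = ee v / ee u" by (simp add: ee_diff)
  have "gen_mu \<tau> (- u) (- v) (of_int 1)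
      = ee v / ee u * (- ?x * appell_lerch 1 ?x ?y) / (theta_const * (- ?y * theta_sum ?y))"
    unfolding gen_mu_eq 1 2 power_int_1_right appell_lerch_inverse[OF off_spiral_ee[OF assms(1)]]
      theta_sum_inverse[OF ee_nonzero] ..
  also have "\<dots> = gen_mu \<tau> u v (of_int 1)"
    unfolding gen_mu_eq by (simp add: ee_double ee_diff power2_eq_square)
  finally show "gen_mu \<tau> (- u) (- v) (of_int 1) = gen_mu \<tau> u v (of_int 1)" .
qed (simp_all add: assms period_lattice_uminus)

text \<open>The translation by \<open>z = - u - v\<close> leads from \<open>(u, v)\<close> to \<open>(- v, - u)\<close>, and its correction contains
  \<open>theta11 \<tau> (u + v + z) = theta11 \<tau> 0 = 0\<close>. Changing both signs leads on to \<open>(v, u)\<close>.\<close>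

lemma gen_mu_commute:
  assumes "u \<notin> period_lattice \<tau>" "v \<notin> period_lattice \<tau>"
  shows "gen_mu \<tau> v u (of_int k) = gen_mu \<tau> u v (of_int k)"
proof -
  have neg: "- u \<notin> period_lattice \<tau>" "- v \<notin> period_lattice \<tau>"
    using assms by (simp_all add: period_lattice_uminus)
  have "gen_mu \<tau> (- v) (- u) (of_int 1) = gen_mu \<tau> u v (of_int 1)"
    using zwegers_translation[OF assms, of "- u - v"] neg by (simp add: theta11_0)
  then have "gen_mu \<tau> (- v) (- u) (of_int k) = gen_mu \<tau> u v (of_int k)"
    by (rule gen_mu_eqI[OF neg(2,1) assms, rotated]) (simp add: algebra_simps)
  then show ?thesis using gen_mu_uminus[OF assms(2,1)] by simp
qed

text \<open>The difference \<open>u - v\<close> is invariant under the translation, so both sides obey the same three-term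
  recurrence, the correction because of that of the Rogers-Szego polynomials. The polynomial
  of index \<open>k\<close> belongs to \<open>\<mu>\<close> at index \<open>k + 1\<close>, so the correction is zero at index \<open>0\<close>, as it must be for a
  constant, and Zwegers' correction at index \<open>1\<close>.\<close>

lemma gen_mu_translation:
  assumes "u \<notin> period_lattice \<tau>" "v \<notin> period_lattice \<tau>"
    and "u + z \<notin> period_lattice \<tau>" "v + z \<notin> period_lattice \<tau>"
  shows "gen_mu \<tau> (u + z) (v + z) (of_int (k + 1)) =
         gen_mu \<tau> u v (of_int (k + 1))
         + \<i> * q_pow \<tau> (1/8) * q_poch_inf q q ^ 3 * theta11 \<tau> z * theta11 \<tau> (u + v + z)
           / (theta11 \<tau> u * theta11 \<tau> v * theta11 \<tau> (u + z) * theta11 \<tau> (v + z))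
           * (exp (- of_real pi * \<i> * of_int k * (u - v)) * q_poch_recip q (q_pow \<tau> (- of_int k)) k)
           * phi11_0 q (q_pow \<tau> (- of_int k)) (exp (2 * of_real pi * \<i> * (u - v)) * q)"
proof -
  define w where "w = ee (u - v)"
  define C where "C = \<i> * q_pow \<tau> (1/8) * q_poch_inf q q ^ 3 * theta11 \<tau> z * theta11 \<tau> (u + v + z)
           / (theta11 \<tau> u * theta11 \<tau> v * theta11 \<tau> (u + z) * theta11 \<tau> (v + z))"
  have w: "w \<noteq> 0" by (simp add: w_def)
  have Q: "q_pow \<tau> (- of_int k) = q powi (- k)" for k by (simp add: q_pow_eq_ee q_powi)
  have c: "2 * cos (of_real pi * (u - v)) = w + 1 / w"
    unfolding cos_eq_ee ee_minus w_def ..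
  have combine: "c * (g + C * r) = d * (g1 + C * r1) + (g2 + C * r2)"
    if "c * g = d * g1 + g2" "c * r = d * r1 + r2" for c d g g1 g2 r r1 r2 :: complex
  proof -
    have "c * (g + C * r) = c * g + C * (c * r)" by (simp add: algebra_simps)
    then show ?thesis unfolding that by (simp add: algebra_simps)
  qed
  have "gen_mu \<tau> (u + z) (v + z) (of_int m) = gen_mu \<tau> u v (of_int m) + C * rogers_szego (m - 1) w" for m
  proof (rule three_term_recurrence_unique[where A = "\<lambda>k. gen_mu \<tau> (u + z) (v + z) (of_int k)"
        and B = "\<lambda>k. gen_mu \<tau> u v (of_int k) + C * rogers_szego (k - 1) w"])
    fix k
    show "(w + 1 / w) * gen_mu \<tau> (u + z) (v + z) (of_int k) =
      (1 - q powi (- k)) * gen_mu \<tau> (u + z) (v + z) (of_int (k + 1)) + gen_mu \<tau> (u + z) (v + z) (of_int (k - 1))"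
      using gen_mu_three_term[OF assms(3), of "v + z" k] unfolding Q by (simp add: c)
    have "(w + 1 / w) * gen_mu \<tau> u v (of_int k) =
      (1 - q powi (- k)) * gen_mu \<tau> u v (of_int (k + 1)) + gen_mu \<tau> u v (of_int (k - 1))"
      using gen_mu_three_term[OF assms(1), of v k] unfolding Q c .
    moreover have "(w + 1 / w) * rogers_szego (k - 1) w =
      (1 - q powi (- k)) * rogers_szego (k + 1 - 1) w + rogers_szego (k - 1 - 1) w"
      using rogers_szego_recurrence[OF w, of "k - 1"] by simp
    ultimately show "(w + 1 / w) * (gen_mu \<tau> u v (of_int k) + C * rogers_szego (k - 1) w) =
      (1 - q powi (- k)) * (gen_mu \<tau> u v (of_int (k + 1)) + C * rogers_szego (k + 1 - 1) w)
      + (gen_mu \<tau> u v (of_int (k - 1)) + C * rogers_szego (k - 1 - 1) w)"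
      by (rule combine)
  next
    show "1 - q powi (- k) \<noteq> 0" if "0 < k" for k
      using that by (intro one_minus_q_powi_nonzero) simp
    show "gen_mu \<tau> (u + z) (v + z) (of_int 0) = gen_mu \<tau> u v (of_int 0) + C * rogers_szego (0 - 1) w"
      unfolding gen_mu_0[OF assms(3,4)] gen_mu_0[OF assms(1,2)] by (simp add: rogers_szego_neg)
    show "gen_mu \<tau> (u + z) (v + z) (of_int 1) = gen_mu \<tau> u v (of_int 1) + C * rogers_szego (1 - 1) w"
      unfolding zwegers_translation[OF assms] C_def by (simp add: rogers_szego_0)
  qed
  from this[of "k + 1"] have "gen_mu \<tau> (u + z) (v + z) (of_int (k + 1))
      = gen_mu \<tau> u v (of_int (k + 1)) + C * rogers_szego k w" by simp
  moreover have "exp (- of_real pi * \<i> * of_int k * (u - v)) = w powi (- k)"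
    unfolding exp_eq_ee w_def ee_powi by simp
  moreover have "exp (2 * of_real pi * \<i> * (u - v)) = w\<^sup>2"
    unfolding exp_eq_ee w_def ee_double ..
  ultimately show ?thesis
    unfolding C_def[symmetric] Q phi11_0_eq_rogers_szego[OF w, symmetric] by (simp only: mult.assoc)
qed

lemma gen_mu_product_form:
  assumes "u \<notin> period_lattice \<tau>" "0 < k"
  shows "gen_mu \<tau> u v (of_int k) =
         exp (of_real pi * \<i> * of_int k * (u - v)) / theta11 \<tau> v *
         (\<Sum>\<^sub>\<infinity>n\<in>(UNIV :: int set).
            (-1) powi n * exp (2 * of_real pi * \<i> * (of_int n + 1/2) * v)
            * q_pow \<tau> (of_int n * (of_int n + 1) / 2)
            * (\<Prod>l = 0..k - 1. 1 / (1 - exp (2 * of_real pi * \<i> * u) * q_pow \<tau> (of_int (n - l)))))"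
proof -
  have "mu_factor k (ee (2 * u) * q powi n) =
      (\<Prod>l = 0..k - 1. 1 / (1 - exp (2 * of_real pi * \<i> * u) * q_pow \<tau> (of_int (n - l))))" for n
  proof -
    have "mu_factor k (ee (2 * u) * q powi n) = (\<Prod>l<nat k. 1 / (1 - ee (2 * u) * q powi n * q powi (- int l)))"
    proof -
      have "mu_factor (int (nat k)) (ee (2 * u) * q powi n) = (\<Prod>l<nat k. 1 / (1 - ee (2 * u) * q powi n * q powi (- int l)))"
        by (rule mu_factor_nat) (intro off_spiral_shift off_spiral_ee assms(1))
      then show ?thesis using assms(2) by simp
    qed
    also have "\<dots> = (\<Prod>l = 0..k - 1. 1 / (1 - exp (2 * of_real pi * \<i> * u) * q_pow \<tau> (of_int (n - l))))"
    proof (rule prod.reindex_bij_witness[where i = nat and j = int])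
      fix l :: nat
      have "q powi n * q powi (- int l) = q_pow \<tau> (of_int (n - int l))"
        using power_int_add[of q n "- int l"] by (simp add: q_pow_eq_ee ee_powi mult_ac)
      then show "1 / (1 - exp (2 * of_real pi * \<i> * u) * q_pow \<tau> (of_int (n - int l)))
          = 1 / (1 - ee (2 * u) * q powi n * q powi (- int l))"
        unfolding exp_eq_ee unfolding mult.assoc by simp
    qed (use assms(2) in auto)
    finally show ?thesis .
  qed
  then show ?thesis unfolding gen_mu_def gen_mu_summand_factor by (simp only:)
qed

lemma gen_mu_as_zwegers_sum:
  assumes "u \<notin> period_lattice \<tau>" "0 < k"
  shows "gen_mu \<tau> u v (of_int k) =
         exp (of_real pi * \<i> * of_int (k - 1) * (u - v + \<tau>)) *
         (\<Sum>j = 0..k - 1.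
            (-1) powi (k - 1 - j) / (q_poch q q j * q_poch q q (k - 1 - j))
            * q_pow \<tau> ((of_int (k - 1 - j))\<^sup>2 / 2)
            * zwegers_mu \<tau> (u - of_int j * \<tau>) v)"
proof -
  define a where "a = nat (k - 1)"
  have k: "k - 1 = int a" "k = int (Suc a)" using assms(2) by (simp_all add: a_def)
  define w where "w = ee (u - v)"
  define K where "K = theta_const * theta_sum (ee (2 * v))"
  let ?L = "\<lambda>j. appell_lerch 1 (ee (2 * u) * q powi (- j)) (ee (2 * v))"
  have w: "w \<noteq> 0" by (simp add: w_def)
  have "gen_mu \<tau> u v (of_int k) = w powi k / K *
      (\<Sum>j\<le>a. theta_coeff (int a - int j) * recip_qfact (int j) * recip_qfact (int a - int j) * ?L (int j))"
    unfolding gen_mu_eq w_def[symmetric] K_def[symmetric] k(2)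
      appell_lerch_partial_fractions[OF off_spiral_ee[OF assms(1)]] by simp
  also have "\<dots> = (\<Sum>j\<le>a. w powi k / K *
      (theta_coeff (int a - int j) * recip_qfact (int j) * recip_qfact (int a - int j) * ?L (int j)))"
    by (rule sum_distrib_left)
  also have "\<dots> = (\<Sum>j = 0..k - 1. exp (of_real pi * \<i> * of_int (k - 1) * (u - v + \<tau>)) *
            ((-1) powi (k - 1 - j) / (q_poch q q j * q_poch q q (k - 1 - j))
            * q_pow \<tau> ((of_int (k - 1 - j))\<^sup>2 / 2)
            * zwegers_mu \<tau> (u - of_int j * \<tau>) v))"
  proof (rule sum.reindex_bij_witness[where i = nat and j = int])
    fix j assume "j \<in> {..a}"
    then have j: "int a - int j = int (a - j)" by (simp add: of_nat_diff)
    let ?M = "int a - int j"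
    have off: "u - of_int (int j) * \<tau> \<notin> period_lattice \<tau>"
      using period_lattice_add_tau[OF assms(1), of "- int j"] by simp
    have e1: "ee (2 * (u - of_int (int j) * \<tau>)) = ee (2 * u) * q powi (- int j)"
      unfolding q_powi ee_add[symmetric] by (simp add: algebra_simps)
    have e2: "ee (u - of_int (int j) * \<tau> - v) = w * ee (- (of_int (int j) * \<tau>))"
      unfolding w_def ee_add[symmetric] by (simp add: algebra_simps)
    have Z: "zwegers_mu \<tau> (u - of_int (int j) * \<tau>) v = w * ee (- (of_int (int j) * \<tau>)) * ?L (int j) / K"
      unfolding zwegers_mu_eq_gen_mu[OF off] gen_mu_eq e1 e2 K_def by simp
    have E: "exp (of_real pi * \<i> * of_int (k - 1) * (u - v + \<tau>)) = w powi int a * ee (of_int (int a) * \<tau>)"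
      unfolding exp_eq_ee k(1) w_def ee_powi by (simp add: distrib_left ee_add)
    (* M (M + 1) / 2 = M^2 / 2 + a / 2 - j / 2 for M = a - j: the powers of q^(1/2) on the right come from
       the prefactor and from the shift of the first argument by - j \<tau>. *)
    have T: "theta_coeff ?M = (-1) powi ?M * (q_pow \<tau> ((of_int ?M)\<^sup>2 / 2) *
        (ee (of_int (int a) * \<tau>) * ee (- (of_int (int j) * \<tau>))))"
      unfolding theta_coeff_ee q_pow_eq_ee ee_of_int[symmetric] ee_add[symmetric]
      by (rule arg_cong[of _ _ ee]) (simp add: field_simps power2_eq_square)
    have P: "q_poch q q (int j) = 1 / recip_qfact (int j)" "q_poch q q ?M = 1 / recip_qfact ?M"
      unfolding j by (rule q_poch_eq_recip_qfact)+
    have W: "w powi k = w powi int a * w" using w by (simp add: k(2) power_int_add)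
    show "exp (of_real pi * \<i> * of_int (k - 1) * (u - v + \<tau>)) *
            ((-1) powi (k - 1 - int j) / (q_poch q q (int j) * q_poch q q (k - 1 - int j))
            * q_pow \<tau> ((of_int (k - 1 - int j))\<^sup>2 / 2)
            * zwegers_mu \<tau> (u - of_int (int j) * \<tau>) v)
        = w powi k / K * (theta_coeff ?M * recip_qfact (int j) * recip_qfact ?M * ?L (int j))"
      unfolding E Z W unfolding k(1) P T by simp
  qed (use k in auto)
  finally show ?thesis unfolding sum_distrib_left .
qed

end

theorem corollary1p5:
  fixes \<tau> q u v :: complex and k :: int
  assumes "Im \<tau> > 0"
    and "q = exp (2 * of_real pi * \<i> * \<tau>)"
    and "u \<notin> period_lattice \<tau>" and "v \<notin> period_lattice \<tau>"
  shows
    \<comment> \<open>(i)\<close>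
    "(gen_mu \<tau> (u + 1) v (of_int k) = (-1) powi k * gen_mu \<tau> u v (of_int k) \<and>
      gen_mu \<tau> u (v + 1) (of_int k) = (-1) powi k * gen_mu \<tau> u v (of_int k))
     \<and>
     \<comment> \<open>(ii)\<close>
     gen_mu \<tau> (u + \<tau>) v (of_int k) =
       - exp (2 * of_real pi * \<i> * (u - v)) * q_pow \<tau> (of_int k / 2) * gen_mu \<tau> u v (of_int k)
       + exp (of_real pi * \<i> * (u - v)) * q_pow \<tau> (of_int k / 2) * gen_mu \<tau> u v (of_int (k - 1))
     \<and>
     \<comment> \<open>(iii)\<close>
     gen_mu \<tau> (u - \<tau>) v (of_int k) =
       q_pow \<tau> (of_int k / 2) * gen_mu \<tau> u v (of_int k)
       - 2 * \<i> * exp (- of_real pi * \<i> * (u - v)) * sin (of_real pi * of_int k * \<tau>)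
         * gen_mu \<tau> u v (of_int (k + 1))
     \<and>
     \<comment> \<open>(iv)\<close>
     (\<forall>z. u + z \<notin> period_lattice \<tau> \<and> v + z \<notin> period_lattice \<tau> \<longrightarrow>
       gen_mu \<tau> (u + z) (v + z) (of_int (k + 1)) =
         gen_mu \<tau> u v (of_int (k + 1))
         + \<i> * q_pow \<tau> (1/8) * q_poch_inf q q ^ 3 * theta11 \<tau> z * theta11 \<tau> (u + v + z)
           / (theta11 \<tau> u * theta11 \<tau> v * theta11 \<tau> (u + z) * theta11 \<tau> (v + z))
           * (exp (- of_real pi * \<i> * of_int k * (u - v)) * q_poch_recip q (q_pow \<tau> (- of_int k)) k)
           * phi11_0 q (q_pow \<tau> (- of_int k)) (exp (2 * of_real pi * \<i> * (u - v)) * q))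
     \<and>
     \<comment> \<open>(v)\<close>
     (gen_mu \<tau> u v (of_int k) = gen_mu \<tau> (u + \<tau>) (v + \<tau>) (of_int k) \<and>
      gen_mu \<tau> u v (of_int k) = gen_mu \<tau> v u (of_int k) \<and>
      gen_mu \<tau> u v (of_int k) = gen_mu \<tau> (- u) (- v) (of_int k))
     \<and>
     \<comment> \<open>(vi)\<close>
     2 * cos (of_real pi * (u - v)) * gen_mu \<tau> u v (of_int k) =
       (1 - q_pow \<tau> (- of_int k)) * gen_mu \<tau> u v (of_int (k + 1)) + gen_mu \<tau> u v (of_int (k - 1))
     \<and>
     \<comment> \<open>(vii)\<close>
     (0 < k \<longrightarrow>
       gen_mu \<tau> u v (of_int k) =
         exp (of_real pi * \<i> * of_int k * (u - v)) / theta11 \<tau> v *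
         (\<Sum>\<^sub>\<infinity>n\<in>(UNIV :: int set).
            (-1) powi n * exp (2 * of_real pi * \<i> * (of_int n + 1/2) * v)
            * q_pow \<tau> (of_int n * (of_int n + 1) / 2)
            * (\<Prod>l = 0..k - 1. 1 / (1 - exp (2 * of_real pi * \<i> * u) * q_pow \<tau> (of_int (n - l)))))
       \<and>
       gen_mu \<tau> u v (of_int k) =
         exp (of_real pi * \<i> * of_int (k - 1) * (u - v + \<tau>)) *
         (\<Sum>j = 0..k - 1.
            (-1) powi (k - 1 - j) / (q_poch q q j * q_poch q q (k - 1 - j))
            * q_pow \<tau> ((of_int (k - 1 - j))\<^sup>2 / 2)
            * zwegers_mu \<tau> (u - of_int j * \<tau>) v))"
proof -
  interpret upper_half_plane \<tau> by standard fact
  have q: "q = ee (2 * \<tau>)" using assms(2) by (simp add: ee_def mult_ac)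
  note u = assms(3) and v = assms(4)
  show ?thesis
    unfolding q
  proof (intro conjI allI impI, goal_cases)
    case 1
    show ?case by (rule gen_mu_plus_1_left)
  next
    case 2
    show ?case by (rule gen_mu_plus_1_right)
  next
    case 3
    show ?case by (rule gen_mu_plus_tau[OF u])
  next
    case 4
    show ?case by (rule gen_mu_minus_tau[OF u])
  next
    case (5 z)
    then show ?case by (intro gen_mu_translation[OF u v]) simp_all
  next
    case 6
    show ?case by (rule gen_mu_plus_tau_both[OF u v, symmetric])
  next
    case 7
    show ?case by (rule gen_mu_commute[OF u v, symmetric])
  next
    case 8
    show ?case by (rule gen_mu_uminus[OF u v, symmetric])
  next
    case 9
    show ?case by (rule gen_mu_three_term[OF u])
  next
    case 10
    then show ?case by (rule gen_mu_product_form[OF u])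
  next
    case 11
    then show ?case by (rule gen_mu_as_zwegers_sum[OF u])
  qed
qed

end
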